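(* Let $k\ge3$ and let $n_1,\dots,n_r\ge2$ be even integers. For $1\le i\le r$ let $\mathcal{F}^1_i,\dots,\mathcal{F}^k_i$ be pairwise almost orthogonal symmetric chain decompositions of $Q_{n_i}$ forming a good collection. Then there exist $k$ pairwise almost orthogonal symmetric chain decompositions $\mathcal{H}^1,\dots,\mathcal{H}^k$ of $Q_{n_1+\cdots+n_r}$ such that for each $j$ every chain of $\mathcal{H}^j$ is contained in a cuboid $A_1\times\cdots\times A_r$ with $A_i\in\mathcal{F}^j_i$ for all $i$.
   Context: $Q_n$ denotes the Boolean lattice of subsets of $[n]=\{1,\dots,n\}$ under inclusion; $Q_{n_1}\times\cdots\times Q_{n_r}$ (product order) is identified with $Q_{n_1+\cdots+n_r}$. A symmetric chain in $Q_n$ consists of exactly one subset of each size $j,\dots,n-j$ for some $j$; a symmetric chain decomposition (SCD) is a partition into symmetric chains. Two SCDs $\mathcal{F},\mathcal{G}$ of $Q_n$ are almost orthogonal if for all chains $A\in\mathcal{F}$, $B\in\mathcal{G}$, $|A\cap B|\le1$, except when $A$ and $B$ both contain $\varnothing$ and $[n]$, in which case $|A\cap B|=2$. For $n$ even, a collection $\{\mathcal{F}^j\}$ of pairwise almost orthogonal SCDs of $Q_n$ is good if the $1$-element chains occurring in the different $\mathcal{F}^j$ are pairwise distinct (no $1$-element chain belongs to two different $\mathcal{F}^j$). *)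

theory Defs
  imports Main "HOL-Library.Disjoint_Sets"
begin

definition boolean_lattice :: "nat \<Rightarrow> nat set set" where
  "boolean_lattice n = Pow {1..n}"

definition symmetric_chain :: "nat \<Rightarrow> nat set set \<Rightarrow> bool" where
  "symmetric_chain n C \<longleftrightarrow>
     C \<subseteq> boolean_lattice n \<and> chain_subset C \<and>
     (\<exists>j. 2 * j \<le> n \<and>
          (\<forall>S\<in>C. card S \<in> {j..n - j}) \<and>
          (\<forall>m\<in>{j..n - j}. \<exists>!S. S \<in> C \<and> card S = m))"

definition symmetric_chain_decomposition :: "nat \<Rightarrow> nat set set set \<Rightarrow> bool" where
  "symmetric_chain_decomposition n \<F> \<longleftrightarrow>
     partition_on (boolean_lattice n) \<F> \<and> (\<forall>C\<in>\<F>. symmetric_chain n C)"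

definition almost_orthogonal :: "nat \<Rightarrow> nat set set set \<Rightarrow> nat set set set \<Rightarrow> bool" where
  "almost_orthogonal n \<F> \<G> \<longleftrightarrow>
     (\<forall>A\<in>\<F>. \<forall>B\<in>\<G>.
        if {{}, {1..n}} \<subseteq> A \<and> {{}, {1..n}} \<subseteq> B
        then card (A \<inter> B) = 2 else card (A \<inter> B) \<le> 1)"

definition pairwise_almost_orthogonal_SCDs ::
    "nat \<Rightarrow> nat \<Rightarrow> (nat \<Rightarrow> nat set set set) \<Rightarrow> bool" where
  "pairwise_almost_orthogonal_SCDs n k \<F> \<longleftrightarrow>
     (\<forall>j\<in>{1..k}. symmetric_chain_decomposition n (\<F> j)) \<and>
     (\<forall>j\<in>{1..k}. \<forall>l\<in>{1..k}. j \<noteq> l \<longrightarrow> almost_orthogonal n (\<F> j) (\<F> l))"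

definition good_collection :: "nat \<Rightarrow> nat \<Rightarrow> (nat \<Rightarrow> nat set set set) \<Rightarrow> bool" where
  "good_collection n k \<F> \<longleftrightarrow>
     even n \<and> pairwise_almost_orthogonal_SCDs n k \<F> \<and>
     (\<forall>j\<in>{1..k}. \<forall>l\<in>{1..k}. j \<noteq> l \<longrightarrow>
        \<not> (\<exists>C. card C = 1 \<and> C \<in> \<F> j \<and> C \<in> \<F> l))"

text \<open>
  The identification of a product of Boolean lattices with a single one: the ground sets
  \<open>{1..n 1}, \<dots>, {1..n r}\<close> are laid out as consecutive blocks of
  \<open>{1..n 1 + \<dots> + n r}\<close>, and a tuple \<open>(S 1, \<dots>, S r)\<close> is sent to the union of the
  shifted components.
\<close>

definition concat_sets :: "nat \<Rightarrow> (nat \<Rightarrow> nat) \<Rightarrow> (nat \<Rightarrow> nat set) \<Rightarrow> nat set" where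
  "concat_sets r n S = (\<Union>i\<in>{1..r}. (\<lambda>x. (\<Sum>l = 1..<i. n l) + x) ` S i)"

definition cuboid :: "nat \<Rightarrow> (nat \<Rightarrow> nat) \<Rightarrow> (nat \<Rightarrow> nat set set) \<Rightarrow> nat set set" where
  "cuboid r n A = {concat_sets r n S | S. \<forall>i\<in>{1..r}. S i \<in> A i}"

end

(*
  If two elements x < y lie on a chain of H^j and on a chain of H^l with j distinct from l, then
  in each factor either x and y agree or x is empty and y is full there, because the F^j_i are almost
  orthogonal; so y - x is a union of blocks. It is therefore enough to decompose each cuboid
  A_1 x ... x A_r into symmetric chains such that any such pair on one chain forces A_i to be a
  singleton for every block i not contained in y - x: goodness then excludes that two different
  decompositions share the pair unless y - x is everything.

  Every cuboid has such a decomposition when all n_i >= 4 (three almost orthogonal decompositions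
  forming a good collection do not exist for n_i = 2). If some A_i is neither a singleton nor a
  chain from the empty set to the full block, a decomposition without any such pair is built by
  splitting off, one full chain at a time, two hooks from a product of two chains. Otherwise the only pair
  needed is the one whose difference is the union of all the full-chain blocks.
*)
theory Submission
  imports Defs
begin

text \<open>The usual hook in a product of two chains follows a whole side of the grid, so it
  contains \<open>(0, d)\<close> and \<open>(t, d)\<close>. If the first factor is a full chain,
  these two sets differ by exactly its block, and that is a forbidden pair. The repair is to
  interlace two hooks. One contains the lowest and the highest corner, which symmetry puts on a
  common chain anyway, but runs inside the boundary in between; the other takes what is left of the
  two sides and stops short of the last column. In the remaining subgrid the full chain has lost its
  two smallest sets and thereby its only forbidden pair. If at least three sets are left, it can be
  paired with the next full chain, and this is the origin of the bound 4. A chain of an even block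
  that is not a singleton has at least three sets because their number is odd. When all factors
  besides the full chains are singletons, one pair is unavoidable: the least and the greatest set of
  the cuboid lie on one symmetric chain, and they differ by the union of the full-chain
  blocks.\<close>

section \<open>Symmetric chains and products of set families\<close>

definition graded_on :: "(nat \<Rightarrow> 'a set) \<Rightarrow> nat \<Rightarrow> nat \<Rightarrow> bool" where
  "graded_on f a b \<longleftrightarrow> a \<le> b \<and> (\<forall>i\<in>{a..b}. finite (f i) \<and> card (f i) = i) \<and>
     (\<forall>i\<in>{a..b}. \<forall>j\<in>{a..b}. i \<le> j \<longrightarrow> f i \<subseteq> f j)"

definition saturated_chain :: "'a set set \<Rightarrow> nat \<Rightarrow> nat \<Rightarrow> bool" where
  "saturated_chain C a b \<longleftrightarrow> (\<exists>f. graded_on f a b \<and> C = f ` {a..b})"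

text \<open>Fixing the sum \<open>c\<close> of the end ranks fixes the centre of symmetry without
  naming a ground set, so truncated chains and subgrids can be decomposed about the same centre as
  the whole product. \<open>P\<close> carries the extra property wanted of each chain.\<close>

definition decomposable :: "('a set set \<Rightarrow> bool) \<Rightarrow> nat \<Rightarrow> 'a set set \<Rightarrow> bool" where
  "decomposable P c X \<longleftrightarrow> (\<exists>\<D>. partition_on X \<D> \<and>
     (\<forall>C\<in>\<D>. P C \<and> (\<exists>a b. a + b = c \<and> saturated_chain C a b)))"

text \<open>A product of posets realised inside one power set: over disjoint ground sets a pair can
  be recovered from its union.\<close>

definition set_join :: "'a set set \<Rightarrow> 'a set set \<Rightarrow> 'a set set" where
  "set_join X Y = {x \<union> y | x y. x \<in> X \<and> y \<in> Y}"

lemma graded_on_le: "graded_on f a b \<Longrightarrow> a \<le> b"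
  by (simp add: graded_on_def)

lemma graded_on_card: "graded_on f a b \<Longrightarrow> i \<in> {a..b} \<Longrightarrow> card (f i) = i"
  by (simp add: graded_on_def)

lemma graded_on_finite: "graded_on f a b \<Longrightarrow> i \<in> {a..b} \<Longrightarrow> finite (f i)"
  by (simp add: graded_on_def)

lemma graded_on_mono: "graded_on f a b \<Longrightarrow> i \<in> {a..b} \<Longrightarrow> j \<in> {a..b} \<Longrightarrow> i \<le> j \<Longrightarrow> f i \<subseteq> f j"
  by (simp add: graded_on_def)

lemma graded_on_subset:
  "graded_on f a b \<Longrightarrow> a \<le> a' \<Longrightarrow> a' \<le> b' \<Longrightarrow> b' \<le> b \<Longrightarrow> graded_on f a' b'"
  unfolding graded_on_def by auto

lemma set_join_assoc: "set_join (set_join X Y) Z = set_join X (set_join Y Z)"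
proof -
  have *: "set_join X Y = (\<Union>x\<in>X. (\<lambda>y. x \<union> y) ` Y)" for X Y :: "'a set set"
    unfolding set_join_def by blast
  show ?thesis unfolding * by (simp add: image_UN image_image Un_assoc) blast
qed

lemma set_join_commute: "set_join X Y = set_join Y X"
proof -
  have "set_join X Y \<subseteq> set_join Y X" for X Y :: "'a set set"
  proof
    fix z assume "z \<in> set_join X Y"
    then obtain x y where "x \<in> X" "y \<in> Y" "z = x \<union> y" unfolding set_join_def by auto
    then have "z = y \<union> x \<and> y \<in> Y \<and> x \<in> X" by (simp add: Un_commute)
    then show "z \<in> set_join Y X" unfolding set_join_def mem_Collect_eq by (intro exI)
  qed
  then show ?thesis by (intro equalityI)
qed

lemma set_join_left_commute: "set_join X (set_join Y Z) = set_join Y (set_join X Z)"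
  unfolding set_join_assoc[symmetric] by (subst set_join_commute[of X Y]) (rule refl)

lemma set_join_empty_left [simp]: "set_join {{}} X = X"
  unfolding set_join_def by auto

lemma set_join_Un_left: "set_join (X \<union> X') Y = set_join X Y \<union> set_join X' Y"
  unfolding set_join_def by auto

lemma set_join_subset_Pow: "X \<subseteq> Pow G \<Longrightarrow> Y \<subseteq> Pow H \<Longrightarrow> set_join X Y \<subseteq> Pow (G \<union> H)"
  unfolding set_join_def by blast

lemma Un_eq_disjoint_iff:
  assumes "x \<subseteq> G" "x' \<subseteq> G" "y \<subseteq> H" "y' \<subseteq> H" "G \<inter> H = {}"
  shows "x \<union> y = x' \<union> y' \<longleftrightarrow> x = x' \<and> y = y'"
proof -
  have "(x \<union> y) \<inter> G = x" "(x \<union> y) \<inter> H = y" "(x' \<union> y') \<inter> G = x'" "(x' \<union> y') \<inter> H = y'"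
    using assms by auto
  then show ?thesis by auto
qed

lemma set_join_disjoint:
  assumes "X \<subseteq> Pow G" "X' \<subseteq> Pow G" "Y \<subseteq> Pow H" "Y' \<subseteq> Pow H" "G \<inter> H = {}"
    and "X \<inter> X' = {} \<or> Y \<inter> Y' = {}"
  shows "set_join X Y \<inter> set_join X' Y' = {}"
proof (rule ccontr)
  assume "set_join X Y \<inter> set_join X' Y' \<noteq> {}"
  then obtain x y x' y' where xy: "x \<in> X" "y \<in> Y" "x' \<in> X'" "y' \<in> Y'" "x \<union> y = x' \<union> y'"
    unfolding set_join_def by auto
  have "x \<subseteq> G" "x' \<subseteq> G" "y \<subseteq> H" "y' \<subseteq> H" using xy(1-4) assms(1-4) by auto
  then have "x = x' \<and> y = y'"
    using Un_eq_disjoint_iff assms(5) xy(5) by metis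
  then show False using xy assms(6) by blast
qed

text \<open>The premise \<open>C \<subseteq> X\<close> lets a property inherited from all of
  \<open>X\<close> be added to the chains afterwards.\<close>

lemma decomposable_mono:
  assumes "decomposable P c X" "\<And>C. C \<subseteq> X \<Longrightarrow> P C \<Longrightarrow> Q C"
  shows "decomposable Q c X"
proof -
  obtain \<D> where "partition_on X \<D>"
    "\<forall>C\<in>\<D>. P C \<and> (\<exists>a b. a + b = c \<and> saturated_chain C a b)"
    using assms(1) unfolding decomposable_def by blast
  moreover from this have "\<forall>C\<in>\<D>. C \<subseteq> X" by (auto simp: partition_on_def)
  ultimately have "partition_on X \<D> \<and> (\<forall>C\<in>\<D>. Q C \<and> (\<exists>a b. a + b = c \<and> saturated_chain C a b))"
    using assms(2) by simp
  then show ?thesis unfolding decomposable_def by (rule exI)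
qed

lemma decomposable_UN:
  assumes dec: "\<And>k. k \<in> K \<Longrightarrow> decomposable P c (X k)"
    and disj: "\<And>k l. k \<in> K \<Longrightarrow> l \<in> K \<Longrightarrow> k \<noteq> l \<Longrightarrow> X k \<inter> X l = {}"
  shows "decomposable P c (\<Union>k\<in>K. X k)"
proof -
  have "\<forall>k\<in>K. \<exists>\<D>. partition_on (X k) \<D> \<and>
      (\<forall>C\<in>\<D>. P C \<and> (\<exists>a b. a + b = c \<and> saturated_chain C a b))"
    using dec unfolding decomposable_def by simp
  from bchoice[OF this] obtain \<D> where *: "\<forall>k\<in>K. partition_on (X k) (\<D> k) \<and>
      (\<forall>C\<in>\<D> k. P C \<and> (\<exists>a b. a + b = c \<and> saturated_chain C a b))" ..
  have \<D>: "partition_on (X k) (\<D> k)" if "k \<in> K" for k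
    using * that by simp
  have sub: "p \<subseteq> X k" if "k \<in> K" "p \<in> \<D> k" for k p
    using that \<D> by (auto simp: partition_on_def)
  have "partition_on (\<Union>k\<in>K. X k) (\<Union>k\<in>K. \<D> k)"
  proof (rule partition_onI)
    have "X k = \<Union> (\<D> k)" if "k \<in> K" for k
      using \<D>[OF that] by (rule partition_onD1)
    then have "(\<Union>k\<in>K. X k) = (\<Union>k\<in>K. \<Union> (\<D> k))" by (rule SUP_cong[OF refl])
    then show "\<Union> (\<Union>k\<in>K. \<D> k) = (\<Union>k\<in>K. X k)" by auto
    show "{} \<notin> (\<Union>k\<in>K. \<D> k)"
      using \<D> by (auto simp: partition_on_def)
    show "disjnt p q" if p: "p \<in> (\<Union>k\<in>K. \<D> k)" and q: "q \<in> (\<Union>k\<in>K. \<D> k)" and ne: "p \<noteq> q" for p q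
    proof -
      obtain k l where kl: "k \<in> K" "p \<in> \<D> k" "l \<in> K" "q \<in> \<D> l" using p q by (elim UN_E)
      show ?thesis
      proof (cases "k = l")
        case True
        then have "p \<in> \<D> k" "q \<in> \<D> k" using kl by simp_all
        then show ?thesis using \<D>[OF kl(1)] ne by (auto simp: partition_on_def disjoint_def disjnt_def)
      next
        case False
        then have "X k \<inter> X l = {}" using disj kl by simp
        then show ?thesis using sub[OF kl(1,2)] sub[OF kl(3,4)] unfolding disjnt_def by auto
      qed
    qed
  qed
  moreover have "\<forall>C\<in>(\<Union>k\<in>K. \<D> k). P C \<and> (\<exists>a b. a + b = c \<and> saturated_chain C a b)"
    using * by simp
  ultimately show ?thesis unfolding decomposable_def by (intro exI conjI)
qed

lemma decomposable_Un:
  assumes "decomposable P c X" "decomposable P c Y" "X \<inter> Y = {}"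
  shows "decomposable P c (X \<union> Y)"
proof -
  have "decomposable P c (\<Union>k\<in>(UNIV :: bool set). if k then X else Y)"
    by (rule decomposable_UN) (use assms in auto)
  then show ?thesis by (simp add: UNIV_bool Un_commute)
qed

lemma decomposable_chain:
  assumes "saturated_chain C a b" "P C" "a + b = c"
  shows "decomposable P c C"
proof -
  have "C \<noteq> {}" using assms(1) unfolding saturated_chain_def graded_on_def by auto
  then have "partition_on C {C}" by (simp add: partition_on_space)
  then show ?thesis using assms unfolding decomposable_def by blast
qed

text \<open>Members of equal size coincide, by \<open>sub\<close> applied in both directions, so one
  arbitrary choice per rank already enumerates \<open>C\<close>.\<close>

lemma saturated_chainI:
  assumes "a \<le> b"
    and rank: "\<And>x. x \<in> C \<Longrightarrow> finite x \<and> card x \<in> {a..b}"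
    and sub: "\<And>x y. x \<in> C \<Longrightarrow> y \<in> C \<Longrightarrow> card x \<le> card y \<Longrightarrow> x \<subseteq> y"
    and ex: "\<And>i. i \<in> {a..b} \<Longrightarrow> \<exists>x\<in>C. card x = i"
  shows "saturated_chain C a b"
proof -
  define f where "f i = (SOME x. x \<in> C \<and> card x = i)" for i
  have f: "f i \<in> C \<and> card (f i) = i" if "i \<in> {a..b}" for i
    unfolding f_def by (rule someI_ex) (use ex[OF that] in blast)
  have "graded_on f a b"
    unfolding graded_on_def using f rank sub assms(1) by simp
  moreover have "C = f ` {a..b}"
  proof
    show "f ` {a..b} \<subseteq> C" using f by auto
    show "C \<subseteq> f ` {a..b}"
    proof
      fix x assume x: "x \<in> C"
      then have "x = f (card x)"
        using f[OF rank[OF x, THEN conjunct2]] sub[of x "f (card x)"] sub[of "f (card x)" x] by simp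
      then show "x \<in> f ` {a..b}" using rank[OF x] by (intro image_eqI[of _ _ "card x"]) simp_all
    qed
  qed
  ultimately show ?thesis unfolding saturated_chain_def by blast
qed

section \<open>Lattice paths in a grid and unrestricted decompositions of products\<close>

text \<open>As the ground sets are disjoint, the rank of \<open>f i \<union> g j\<close> is
  \<open>i + j\<close>. A saturated chain therefore is a set of grid points that increases in both
  coordinates and meets every antidiagonal between \<open>lo\<close> and \<open>hi\<close>.\<close>

lemma saturated_chain_grid:
  assumes f: "graded_on f a b" and g: "graded_on g c d"
    and fG: "f ` {a..b} \<subseteq> Pow G" and gH: "g ` {c..d} \<subseteq> Pow H" and GH: "G \<inter> H = {}"
    and "K \<subseteq> {a..b} \<times> {c..d}" and "lo \<le> hi"
    and rank: "\<And>i j. (i, j) \<in> K \<Longrightarrow> lo \<le> i + j \<and> i + j \<le> hi"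
    and mono: "\<And>i j i' j'. (i, j) \<in> K \<Longrightarrow> (i', j') \<in> K \<Longrightarrow> i + j \<le> i' + j' \<Longrightarrow> i \<le> i' \<and> j \<le> j'"
    and ex: "\<And>k. lo \<le> k \<Longrightarrow> k \<le> hi \<Longrightarrow> \<exists>i j. (i, j) \<in> K \<and> i + j = k"
  shows "saturated_chain ((\<lambda>(i, j). f i \<union> g j) ` K) lo hi"
proof -
  have K: "i \<in> {a..b}" "j \<in> {c..d}" if "(i, j) \<in> K" for i j using that assms(6) by auto
  have card: "card (f i \<union> g j) = i + j" if "(i, j) \<in> K" for i j
  proof -
    have "f i \<subseteq> G" "g j \<subseteq> H" using fG gH K[OF that] by (simp_all add: image_subset_iff)
    then have "f i \<inter> g j = {}" using GH by auto
    then have "card (f i \<union> g j) = card (f i) + card (g j)"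
      using graded_on_finite[OF f] graded_on_finite[OF g] K[OF that] by (intro card_Un_disjoint) auto
    then show ?thesis using graded_on_card[OF f] graded_on_card[OF g] K[OF that] by simp
  qed
  show ?thesis
  proof (rule saturated_chainI)
    fix x assume "x \<in> (\<lambda>(i, j). f i \<union> g j) ` K"
    then obtain i j where ij: "(i, j) \<in> K" "x = f i \<union> g j" by auto
    show "finite x \<and> card x \<in> {lo..hi}"
      using card[OF ij(1)] rank[OF ij(1)] graded_on_finite[OF f] graded_on_finite[OF g] K[OF ij(1)] ij(2)
      by simp
    fix y assume "y \<in> (\<lambda>(i, j). f i \<union> g j) ` K" and le: "card x \<le> card y"
    then obtain i' j' where ij': "(i', j') \<in> K" "y = f i' \<union> g j'" by auto
    then have "i \<le> i' \<and> j \<le> j'" using mono card ij le by simp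
    then have "f i \<subseteq> f i'" "g j \<subseteq> g j'"
      using graded_on_mono[OF f] graded_on_mono[OF g] K[OF ij(1)] K[OF ij'(1)] by simp_all
    then show "x \<subseteq> y" using ij ij' by auto
  next
    fix k assume "k \<in> {lo..hi}"
    then obtain i j where "(i, j) \<in> K" "i + j = k" using ex[of k] by auto
    then show "\<exists>x\<in>(\<lambda>(i, j). f i \<union> g j) ` K. card x = k"
      using card by (intro bexI[of _ "f i \<union> g j"]) (auto intro: image_eqI[of _ _ "(i, j)"])
  qed fact
qed

lemma saturated_chain_image: "graded_on f a b \<Longrightarrow> saturated_chain (f ` {a..b}) a b"
  unfolding saturated_chain_def by blast

lemma set_join_images:
  "set_join (f ` I) (g ` J) = (\<lambda>(i, j). f i \<union> g j) ` (I \<times> J)"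
proof (intro equalityI subsetI)
  fix z assume "z \<in> set_join (f ` I) (g ` J)"
  then obtain i j where "z = f i \<union> g j" "i \<in> I" "j \<in> J" unfolding set_join_def by auto
  then show "z \<in> (\<lambda>(i, j). f i \<union> g j) ` (I \<times> J)" by (intro image_eqI[of _ _ "(i, j)"]) simp_all
next
  fix z assume "z \<in> (\<lambda>(i, j). f i \<union> g j) ` (I \<times> J)"
  then obtain i j where "z = f i \<union> g j" "i \<in> I" "j \<in> J" by auto
  then show "z \<in> set_join (f ` I) (g ` J)"
    unfolding set_join_def by auto
qed

lemma graded_on_inj:
  "graded_on f a b \<Longrightarrow> i \<in> {a..b} \<Longrightarrow> j \<in> {a..b} \<Longrightarrow> f i = f j \<Longrightarrow> i = j"
  by (metis graded_on_card)

lemma inj_on_grid: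
  assumes f: "graded_on f a b" and g: "graded_on g c d"
    and fG: "f ` {a..b} \<subseteq> Pow G" and gH: "g ` {c..d} \<subseteq> Pow H" and GH: "G \<inter> H = {}"
  shows "inj_on (\<lambda>(i, j). f i \<union> g j) ({a..b} \<times> {c..d})"
proof (rule inj_onI, clarify)
  fix i j i' j'
  assume ij: "i \<in> {a..b}" "j \<in> {c..d}" "i' \<in> {a..b}" "j' \<in> {c..d}" "f i \<union> g j = f i' \<union> g j'"
  then have "f i = f i' \<and> g j = g j'"
    using Un_eq_disjoint_iff[of "f i" G "f i'" "g j" H "g j'"] fG gH GH by blast
  then show "i = i' \<and> j = j'" using ij graded_on_inj[OF f] graded_on_inj[OF g] by blast
qed

text \<open>The classical construction: the left and upper sides form one chain, and the grid
  without them has the same centre. It serves wherever the differences along chains do not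
  matter.\<close>

lemma decomposable_grid:
  assumes "graded_on f a b" and g: "graded_on g c d"
    and "f ` {a..b} \<subseteq> Pow G" and "g ` {c..d} \<subseteq> Pow H" and GH: "G \<inter> H = {}"
  shows "decomposable (\<lambda>_. True) (a + b + c + d) ((\<lambda>(i, j). f i \<union> g j) ` ({a..b} \<times> {c..d}))"
  using assms(1,3) g assms(4)
proof (induction "b - a" arbitrary: a d)
  case 0
  have ab: "a = b" using 0(1) graded_on_le[OF 0(2)] by simp
  have "saturated_chain ((\<lambda>(i, j). f i \<union> g j) ` ({a..b} \<times> {c..d})) (a + c) (a + d)"
    by (rule saturated_chain_grid[OF 0(2,4,3,5) GH])
      (use ab graded_on_le[OF 0(4)] in \<open>auto simp: le_iff_add\<close>)
  then show ?case by (rule decomposable_chain) (use ab in auto)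
next
  case (Suc n)
  let ?\<phi> = "\<lambda>(i, j). f i \<union> g j"
  let ?hook = "{a} \<times> {c..d} \<union> {a..b} \<times> {d}"
  have ab: "Suc a \<le> b" using Suc(2) by simp
  have cd: "c \<le> d" using Suc(5) by (rule graded_on_le)
  have "saturated_chain (?\<phi> ` ?hook) (a + c) (b + d)"
  proof (rule saturated_chain_grid[OF Suc(3,5,4,6) GH])
    fix k assume "a + c \<le> k" "k \<le> b + d"
    \<comment> \<open>The point of the hook on antidiagonal \<open>k\<close>: in column
      \<open>a\<close> as long as \<open>k \<le> a + d\<close>, in row \<open>d\<close> afterwards.
      In the first case the truncated \<open>k - d\<close> is at most \<open>a\<close>.\<close>
    then have "(max a (k - d), min d (k - a)) \<in> ?hook \<and> max a (k - d) + min d (k - a) = k"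
      using ab cd by (cases "k \<le> a + d") auto
    then show "\<exists>i j. (i, j) \<in> ?hook \<and> i + j = k" by (intro exI)
  qed (use ab cd in auto)
  then have hook: "decomposable (\<lambda>_. True) (a + b + c + d) (?\<phi> ` ?hook)"
    by (rule decomposable_chain) auto
  show ?case
  proof (cases "c = d")
    case True
    then have "?hook = {a..b} \<times> {c..d}" using ab by auto
    then show ?thesis using hook by simp
  next
    case False
    let ?rest = "{Suc a..b} \<times> {c..d - 1}"
    have "decomposable (\<lambda>_. True) (Suc a + b + c + (d - 1)) (?\<phi> ` ?rest)"
    proof (rule Suc(1))
      show "n = b - Suc a" using Suc(2) by simp
      show "graded_on f (Suc a) b" using Suc(3) ab by (auto intro: graded_on_subset)
      show "graded_on g c (d - 1)" using Suc(5) cd False by (auto intro: graded_on_subset)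
      show "f ` {Suc a..b} \<subseteq> Pow G" by (rule order_trans[OF image_mono Suc(4)]) auto
      show "g ` {c..d - 1} \<subseteq> Pow H" by (rule order_trans[OF image_mono Suc(6)]) auto
    qed
    then have rest: "decomposable (\<lambda>_. True) (a + b + c + d) (?\<phi> ` ?rest)"
      using False cd by simp
    have "?\<phi> ` ?hook \<inter> ?\<phi> ` ?rest = ?\<phi> ` (?hook \<inter> ?rest)"
      by (rule inj_on_image_Int[OF inj_on_grid[OF Suc(3,5,4,6) GH], symmetric]) (use ab cd in auto)
    also have "?hook \<inter> ?rest = {}" using cd False by auto
    finally have "decomposable (\<lambda>_. True) (a + b + c + d) (?\<phi> ` ?hook \<union> ?\<phi> ` ?rest)"
      using decomposable_Un[OF hook rest] by simp
    moreover have "?hook \<union> ?rest = {a..b} \<times> {c..d}" using ab cd False by auto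
    ultimately show ?thesis by (metis image_Un)
  qed
qed

lemma decomposable_set_join:
  assumes "decomposable P c X" "decomposable Q e Y"
    and "X \<subseteq> Pow G" "Y \<subseteq> Pow H" and GH: "G \<inter> H = {}"
  shows "decomposable (\<lambda>_. True) (c + e) (set_join X Y)"
proof -
  obtain \<D> where \<D>: "partition_on X \<D>" "\<And>C. C \<in> \<D> \<Longrightarrow> \<exists>a b. a + b = c \<and> saturated_chain C a b"
    using assms(1) unfolding decomposable_def by blast
  obtain \<E> where \<E>: "partition_on Y \<E>" "\<And>C. C \<in> \<E> \<Longrightarrow> \<exists>a b. a + b = e \<and> saturated_chain C a b"
    using assms(2) unfolding decomposable_def by blast
  have sub: "C \<subseteq> Pow G" "D \<subseteq> Pow H" if "C \<in> \<D>" "D \<in> \<E>" for C D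
    using that \<D>(1) \<E>(1) assms(3,4) unfolding partition_on_def by blast+
  have "decomposable (\<lambda>_. True) (c + e) (\<Union>k\<in>\<D> \<times> \<E>. set_join (fst k) (snd k))"
  proof (rule decomposable_UN)
    fix k assume "k \<in> \<D> \<times> \<E>"
    then obtain C D where k: "k = (C, D)" "C \<in> \<D>" "D \<in> \<E>" by blast
    obtain a b f where f: "a + b = c" "graded_on f a b" "C = f ` {a..b}"
      using \<D>(2)[OF k(2)] unfolding saturated_chain_def by blast
    obtain a' b' g where g: "a' + b' = e" "graded_on g a' b'" "D = g ` {a'..b'}"
      using \<E>(2)[OF k(3)] unfolding saturated_chain_def by blast
    show "decomposable (\<lambda>_. True) (c + e) (set_join (fst k) (snd k))"
      using decomposable_grid[OF f(2) g(2) _ _ GH] sub[OF k(2,3)] f g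
      by (simp add: k(1) set_join_images add.assoc)
  next
    fix k l assume kl: "k \<in> \<D> \<times> \<E>" "l \<in> \<D> \<times> \<E>" "k \<noteq> l"
    have "fst k \<inter> fst l = {} \<or> snd k \<inter> snd l = {}"
      using kl \<D>(1) \<E>(1) unfolding partition_on_def disjoint_def
      by (metis mem_Times_iff prod_eq_iff)
    then show "set_join (fst k) (snd k) \<inter> set_join (fst l) (snd l) = {}"
      using set_join_disjoint[of "fst k" G "fst l" "snd k" H "snd l"] sub GH kl
      by (metis mem_Times_iff)
  qed
  moreover have "(\<Union>k\<in>\<D> \<times> \<E>. set_join (fst k) (snd k)) = set_join X Y"
    using partition_onD1[OF \<D>(1)] partition_onD1[OF \<E>(1)] unfolding set_join_def by fastforce
  ultimately show ?thesis by simp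
qed

section \<open>Products over families of blocks\<close>

text \<open>The version of \<open>set_join\<close> with many factors, indexed by a set so that an
  induction can split off any single factor; over consecutive shifted blocks it becomes a
  cuboid.\<close>

definition join_on :: "'i set \<Rightarrow> ('i \<Rightarrow> 'a set set) \<Rightarrow> 'a set set" where
  "join_on I X = {\<Union> (s ` I) | s. \<forall>i\<in>I. s i \<in> X i}"

lemma join_on_empty [simp]: "join_on {} X = {{}}"
  by (simp add: join_on_def)

lemma join_on_Un:
  assumes "I \<inter> J = {}"
  shows "join_on (I \<union> J) X = set_join (join_on I X) (join_on J X)"
proof (intro equalityI subsetI)
  fix z assume "z \<in> join_on (I \<union> J) X"
  then obtain s where s: "z = \<Union> (s ` (I \<union> J))" "\<forall>i\<in>I \<union> J. s i \<in> X i"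
    unfolding join_on_def by blast
  then have "z = \<Union> (s ` I) \<union> \<Union> (s ` J)" "\<Union> (s ` I) \<in> join_on I X" "\<Union> (s ` J) \<in> join_on J X"
    unfolding join_on_def by auto
  then show "z \<in> set_join (join_on I X) (join_on J X)" unfolding set_join_def by blast
next
  fix z assume "z \<in> set_join (join_on I X) (join_on J X)"
  then obtain s s' where s: "z = \<Union> (s ` I) \<union> \<Union> (s' ` J)" "\<forall>i\<in>I. s i \<in> X i" "\<forall>i\<in>J. s' i \<in> X i"
    unfolding set_join_def join_on_def by blast
  let ?t = "\<lambda>i. if i \<in> I then s i else s' i"
  have "?t ` I = s ` I" "?t ` J = s' ` J"
    using assms by (auto intro!: image_cong)
  then have "z = \<Union> (?t ` (I \<union> J))" using s(1) by (simp only: image_Un Union_Un_distrib)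
  moreover have "\<forall>i\<in>I \<union> J. ?t i \<in> X i" using s by auto
  ultimately show "z \<in> join_on (I \<union> J) X" unfolding join_on_def by blast
qed

lemma join_on_singleton: "join_on {i} X = X i"
proof (intro equalityI subsetI)
  fix z assume "z \<in> X i"
  then have "z = \<Union> ((\<lambda>_. z) ` {i}) \<and> (\<forall>i\<in>{i}. z \<in> X i)" by simp
  then show "z \<in> join_on {i} X" unfolding join_on_def by blast
qed (auto simp: join_on_def)

lemma join_on_insert: "i \<notin> I \<Longrightarrow> join_on (insert i I) X = set_join (X i) (join_on I X)"
  using join_on_Un[of "{i}" I X] by (simp add: join_on_singleton)

lemma join_on_subset_Pow: "(\<And>i. i \<in> I \<Longrightarrow> X i \<subseteq> Pow (B i)) \<Longrightarrow> join_on I X \<subseteq> Pow (\<Union> (B ` I))"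
  unfolding join_on_def by blast

lemma join_on_cong: "(\<And>i. i \<in> I \<Longrightarrow> X i = X' i) \<Longrightarrow> join_on I X = join_on I X'"
  unfolding join_on_def by auto

lemma decomposable_join_on:
  assumes "finite I"
    and "\<And>i. i \<in> I \<Longrightarrow> saturated_chain (X i) (a i) (b i)"
    and "\<And>i. i \<in> I \<Longrightarrow> X i \<subseteq> Pow (B i)"
    and "\<And>i j. i \<in> I \<Longrightarrow> j \<in> I \<Longrightarrow> i \<noteq> j \<Longrightarrow> B i \<inter> B j = {}"
  shows "decomposable (\<lambda>_. True) (\<Sum>i\<in>I. a i + b i) (join_on I X)"
  using assms
proof (induction I)
  case empty
  have "saturated_chain {{}} 0 0" by (rule saturated_chainI) auto
  then show ?case by (auto intro: decomposable_chain)
next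
  case (insert i I)
  have "decomposable (\<lambda>_. True) (a i + b i) (X i)"
    by (rule decomposable_chain[OF insert.prems(1)]) auto
  moreover have "decomposable (\<lambda>_. True) (\<Sum>i\<in>I. a i + b i) (join_on I X)"
    by (rule insert.IH) (use insert.prems in auto)
  moreover have "B i \<inter> \<Union> (B ` I) = {}" using insert.prems(3)[of i] insert.hyps(2) by fastforce
  ultimately have "decomposable (\<lambda>_. True) (a i + b i + (\<Sum>i\<in>I. a i + b i)) (set_join (X i) (join_on I X))"
    using insert.prems(2) by (intro decomposable_set_join[OF _ _ _ join_on_subset_Pow]) auto
  then show ?case using insert.hyps by (simp add: join_on_insert)
qed

lemma saturated_chain_le: "saturated_chain C a b \<Longrightarrow> a \<le> b"
  unfolding saturated_chain_def by (auto dest: graded_on_le)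

section \<open>Splitting a grid into two hooks and a subgrid\<close>

text \<open>
  A grid \<open>{0..t} \<times> {c..d}\<close> is cut into two hooks and the subgrid \<open>{2..t} \<times> {c..d - 2}\<close>. The hooks
  bend early enough that neither contains both \<open>(0, j)\<close> and \<open>(t, j)\<close> for any \<open>j\<close>; and the only
  hook containing some \<open>(i, c)\<close> and some \<open>(i', d)\<close> with \<open>i = i'\<close> or \<open>i = 0, i' = t\<close> is the outer
  one, through its two endpoints.
\<close>

definition outer_hook :: "nat \<Rightarrow> nat \<Rightarrow> nat \<Rightarrow> (nat \<times> nat) set" where
  "outer_hook t c d = {(0, c)} \<union> {1} \<times> {c..d - 1} \<union> {1..t} \<times> {d - 1} \<union> {(t, d)}"

definition inner_hook :: "nat \<Rightarrow> nat \<Rightarrow> nat \<Rightarrow> (nat \<times> nat) set" where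
  "inner_hook t c d = {0} \<times> {c + 1..d} \<union> {0..t - 1} \<times> {d}"

locale hooks =
  fixes f g :: "nat \<Rightarrow> 'a set" and t c d :: nat and B G :: "'a set"
  assumes f: "graded_on f 0 t" and g: "graded_on g c d"
    and fB: "f ` {0..t} \<subseteq> Pow B" and gG: "g ` {c..d} \<subseteq> Pow G" and BG: "B \<inter> G = {}"
    and t: "4 \<le> t" and cd: "c + 2 \<le> d"
begin

abbreviation cell :: "nat \<times> nat \<Rightarrow> 'a set" where
  "cell \<equiv> \<lambda>(i, j). f i \<union> g j"

lemma hooks_subset: "outer_hook t c d \<subseteq> {0..t} \<times> {c..d}" "inner_hook t c d \<subseteq> {0..t} \<times> {c..d}"
  using t cd unfolding outer_hook_def inner_hook_def by auto

lemma saturated_chain_outer: "saturated_chain (cell ` outer_hook t c d) c (t + d)"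
proof (rule saturated_chain_grid[OF f g fB gG BG hooks_subset(1)])
  fix k assume k: "c \<le> k" "k \<le> t + d"
  \<comment> \<open>The lowest corner, the vertical leg in column 1, the horizontal leg in row
    \<open>d - 1\<close>, the highest corner.\<close>
  consider "k = c" | "c < k \<and> k \<le> d" | "d < k \<and> k < t + d" | "k = t + d" using k by linarith
  then show "\<exists>i j. (i, j) \<in> outer_hook t c d \<and> i + j = k"
  proof cases
    case 1 then show ?thesis by (intro exI[of _ 0] exI[of _ c]) (simp add: outer_hook_def)
  next
    case 2 then show ?thesis by (intro exI[of _ 1] exI[of _ "k - 1"]) (auto simp: outer_hook_def)
  next
    case 3 then show ?thesis using cd
      by (intro exI[of _ "k - (d - 1)"] exI[of _ "d - 1"]) (auto simp: outer_hook_def)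
  next
    case 4 then show ?thesis by (intro exI[of _ t] exI[of _ d]) (simp add: outer_hook_def)
  qed
qed (use t cd in \<open>auto simp: outer_hook_def\<close>)

lemma saturated_chain_inner: "saturated_chain (cell ` inner_hook t c d) (c + 1) (t + d - 1)"
proof (rule saturated_chain_grid[OF f g fB gG BG hooks_subset(2)])
  fix k assume k: "c + 1 \<le> k" "k \<le> t + d - 1"
  show "\<exists>i j. (i, j) \<in> inner_hook t c d \<and> i + j = k"
  proof (cases "k \<le> d")
    case True then show ?thesis using k by (intro exI[of _ 0] exI[of _ k]) (auto simp: inner_hook_def)
  next
    case False then show ?thesis using k
      by (intro exI[of _ "k - d"] exI[of _ d]) (auto simp: inner_hook_def)
  qed
qed (use t cd in \<open>auto simp: inner_hook_def\<close>)

text \<open>The inner hook is column 0 and row \<open>d\<close> without the corners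
  \<open>(0, c)\<close> and \<open>(t, d)\<close>. The outer hook consists of these corners and of
  the next column and the next row.\<close>

lemma grid_split:
  "set_join (f ` {0..t}) (g ` {c..d}) =
     cell ` outer_hook t c d \<union> cell ` inner_hook t c d \<union> set_join (f ` {2..t}) (g ` {c..d - 2})"
proof -
  have "{0..t} \<times> {c..d} = outer_hook t c d \<union> inner_hook t c d \<union> {2..t} \<times> {c..d - 2}"
  proof (rule equalityI)
    show "{0..t} \<times> {c..d} \<subseteq> outer_hook t c d \<union> inner_hook t c d \<union> {2..t} \<times> {c..d - 2}"
    proof (rule subrelI)
      fix i j
      assume "(i, j) \<in> {0..t} \<times> {c..d}"
      then have ij: "i \<le> t" "c \<le> j" "j \<le> d" by auto
      consider "i = 0" | "0 < i" "j = d" | "0 < i" "j = d - 1" | "i = 1" "j < d - 1" | "2 \<le> i" "j \<le> d - 2"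
        using ij by linarith
      then show "(i, j) \<in> outer_hook t c d \<union> inner_hook t c d \<union> {2..t} \<times> {c..d - 2}"
        by cases (use ij t cd in \<open>auto simp: outer_hook_def inner_hook_def\<close>)
    qed
    have "{2..t} \<times> {c..d - 2} \<subseteq> {0..t} \<times> {c..d}" by auto
    then show "outer_hook t c d \<union> inner_hook t c d \<union> {2..t} \<times> {c..d - 2} \<subseteq> {0..t} \<times> {c..d}"
      using hooks_subset by blast
  qed
  then show ?thesis by (simp only: set_join_images image_Un)
qed

lemma cell_Int_empty:
  "K \<subseteq> {0..t} \<times> {c..d} \<Longrightarrow> L \<subseteq> {0..t} \<times> {c..d} \<Longrightarrow> K \<inter> L = {} \<Longrightarrow> cell ` K \<inter> cell ` L = {}"
  using inj_on_image_Int[OF inj_on_grid[OF f g fB gG BG], of K L] by simp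

lemma hooks_disjoint:
  "cell ` outer_hook t c d \<inter> cell ` inner_hook t c d = {}"
  "cell ` outer_hook t c d \<inter> set_join (f ` {2..t}) (g ` {c..d - 2}) = {}"
  "cell ` inner_hook t c d \<inter> set_join (f ` {2..t}) (g ` {c..d - 2}) = {}"
  unfolding set_join_images
  by (rule cell_Int_empty; use t cd in \<open>auto simp: outer_hook_def inner_hook_def\<close>)+

text \<open>\<open>P\<close> is the product of the factors still to be treated. In
  \<open>rest\<close> the two truncated chains are bracketed apart: \<open>g\<close> is moved to
  \<open>Y\<close>, and \<open>f\<close> stands where the hooks stood, ready to be the distinguished
  chain of the next round.\<close>

lemma decomposable_hooks:
  assumes P: "P \<subseteq> Pow F" "F \<inter> (B \<union> G) = {}"
    and Y: "Y \<subseteq> Pow H" "H \<inter> (B \<union> G \<union> F) = {}"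
    and outer: "decomposable Q e (set_join P (set_join (cell ` outer_hook t c d) Y))"
    and inner: "decomposable Q e (set_join P (set_join (cell ` inner_hook t c d) Y))"
    and rest: "decomposable Q e (set_join P (set_join (f ` {2..t}) (set_join (g ` {c..d - 2}) Y)))"
  shows "decomposable Q e (set_join P (set_join (set_join (f ` {0..t}) (g ` {c..d})) Y))"
proof -
  let ?O = "cell ` outer_hook t c d" and ?I = "cell ` inner_hook t c d"
    and ?R = "set_join (f ` {2..t}) (g ` {c..d - 2})"
  let ?J = "\<lambda>Z. set_join P (set_join Z Y)"
  have sub: "?O \<subseteq> Pow (B \<union> G)" "?I \<subseteq> Pow (B \<union> G)" "?R \<subseteq> Pow (B \<union> G)"
    using set_join_subset_Pow[OF fB gG] unfolding grid_split by auto
  have "?J (?O \<union> ?I \<union> ?R) = ?J ?O \<union> ?J ?I \<union> ?J ?R"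
    by (simp add: set_join_Un_left set_join_commute[of P])
  moreover have "?J Z \<inter> ?J Z' = {}" if "Z \<subseteq> Pow (B \<union> G)" "Z' \<subseteq> Pow (B \<union> G)" "Z \<inter> Z' = {}" for Z Z'
  proof (rule set_join_disjoint[OF P(1,1)])
    show "set_join Z Y \<subseteq> Pow (B \<union> G \<union> H)" "set_join Z' Y \<subseteq> Pow (B \<union> G \<union> H)"
      by (rule set_join_subset_Pow[OF _ Y(1)]; fact)+
    show "F \<inter> (B \<union> G \<union> H) = {}" using P Y by blast
    have "set_join Z Y \<inter> set_join Z' Y = {}"
      by (rule set_join_disjoint[OF that(1,2) Y(1,1)]) (use that Y in auto)
    then show "P \<inter> P = {} \<or> set_join Z Y \<inter> set_join Z' Y = {}" ..
  qed
  then have "?J ?O \<inter> ?J ?I = {}" "?J ?O \<inter> ?J ?R = {}" "?J ?I \<inter> ?J ?R = {}"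
    using sub hooks_disjoint by auto
  ultimately show ?thesis
    using outer inner rest unfolding grid_split
    by (simp only: set_join_assoc) (intro decomposable_Un; auto simp: set_join_assoc)
qed

end

section \<open>Differences that are unions of blocks\<close>

text \<open>
  \<open>U\<close> stands for the unions of blocks of the ground set. A pair \<open>x \<subset> y\<close> with \<open>y - x \<in> U\<close> is what
  two chains belonging to different decompositions might share.
\<close>

locale block_algebra =
  fixes U :: "'a set set"
  assumes Un_closed: "u \<in> U \<Longrightarrow> v \<in> U \<Longrightarrow> u \<union> v \<in> U"
    and Int_closed: "u \<in> U \<Longrightarrow> v \<in> U \<Longrightarrow> u \<inter> v \<in> U"
    and empty_mem: "{} \<in> U"
begin

text \<open>\<open>W\<close> lists the tolerated differences. The family need not be a chain: once a
  whole product satisfies the condition, so does every chain in it.\<close>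

definition gaps_in :: "'a set set \<Rightarrow> 'a set set \<Rightarrow> bool" where
  "gaps_in W X \<longleftrightarrow> (\<forall>x\<in>X. \<forall>y\<in>X. x \<subset> y \<and> y - x \<in> U \<longrightarrow> y - x \<in> W)"

abbreviation gap_free :: "'a set set \<Rightarrow> bool" where
  "gap_free \<equiv> gaps_in {}"

lemma gaps_in_subset: "gaps_in W X \<Longrightarrow> X' \<subseteq> X \<Longrightarrow> gaps_in W X'"
  unfolding gaps_in_def by (meson subset_iff)

lemma gaps_in_mono: "gaps_in W X \<Longrightarrow> W \<subseteq> W' \<Longrightarrow> gaps_in W' X"
  unfolding gaps_in_def by blast

lemma gaps_inD: "gaps_in W X \<Longrightarrow> x \<in> X \<Longrightarrow> y \<in> X \<Longrightarrow> x \<subseteq> y \<Longrightarrow> y - x \<in> U \<Longrightarrow> x = y \<or> y - x \<in> W"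
  unfolding gaps_in_def by blast

text \<open>Intersecting the difference with \<open>G\<close> and with \<open>H\<close>, both
  members of \<open>U\<close>, gives the differences of the two coordinates.\<close>

lemma gap_split:
  assumes "x \<subseteq> G" "x' \<subseteq> G" "y \<subseteq> H" "y' \<subseteq> H" "G \<inter> H = {}" "G \<in> U" "H \<in> U"
    and "x \<union> y \<subseteq> x' \<union> y'" "(x' \<union> y') - (x \<union> y) \<in> U"
  shows "x \<subseteq> x' \<and> x' - x \<in> U \<and> y \<subseteq> y' \<and> y' - y \<in> U"
proof -
  have "x' - x = (x' \<union> y' - (x \<union> y)) \<inter> G" "y' - y = (x' \<union> y' - (x \<union> y)) \<inter> H"
    using assms(1-5) by blast+
  then have "x' - x \<in> U \<and> y' - y \<in> U" using assms(6,7,9) Int_closed by simp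
  moreover have "x \<subseteq> x'" "y \<subseteq> y'" using assms(1-5,8) by blast+
  ultimately show ?thesis by simp
qed

text \<open>By \<open>gap_split\<close> each coordinate contributes a member of \<open>U\<close>. In
  \<open>Y\<close> it must be empty, so the whole difference comes from \<open>X\<close>.\<close>

lemma gaps_in_set_join:
  assumes "X \<subseteq> Pow G" "Y \<subseteq> Pow H" "G \<inter> H = {}" "G \<in> U" "H \<in> U"
    and "gaps_in W X" "\<And>y y'. y \<in> Y \<Longrightarrow> y' \<in> Y \<Longrightarrow> y \<subseteq> y' \<Longrightarrow> y' - y \<in> U \<Longrightarrow> y = y'"
  shows "gaps_in W (set_join X Y)"
  unfolding gaps_in_def
proof (intro ballI impI)
  fix z z' assume "z \<in> set_join X Y" "z' \<in> set_join X Y" and zz': "z \<subset> z' \<and> z' - z \<in> U"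
  then obtain x y x' y' where *: "x \<in> X" "y \<in> Y" "z = x \<union> y" "x' \<in> X" "y' \<in> Y" "z' = x' \<union> y'"
    unfolding set_join_def by blast
  then have s: "x \<subseteq> x' \<and> x' - x \<in> U \<and> y \<subseteq> y' \<and> y' - y \<in> U"
    using gap_split[of x G x' y H y'] assms(1-5) zz' by blast
  then have "y = y'" using assms(7) * by blast
  moreover from this have "x' - x \<in> W" using gaps_inD[OF assms(6)] * s zz' by blast
  moreover have "x' \<inter> y = {}" using * assms(1-3) by blast
  then have "(x' \<union> y) - (x \<union> y) = x' - x" by blast
  ultimately show "z' - z \<in> W" using * by simp
qed

lemma gap_free_set_join:
  assumes "X \<subseteq> Pow G" "Y \<subseteq> Pow H" "G \<inter> H = {}" "G \<in> U" "H \<in> U" "gap_free X" "gap_free Y"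
  shows "gap_free (set_join X Y)"
  by (rule gaps_in_set_join[OF assms(1-6)]) (use gaps_inD[OF assms(7)] in blast)

text \<open>For a single block the condition \<open>gaps_in {B}\<close> holds automatically. It is
  demanded because merged blocks are to be spanned as well, and for those \<open>U\<close> also
  contains the smaller blocks they are made of.\<close>

definition spanning :: "'a set \<Rightarrow> (nat \<Rightarrow> 'a set) \<Rightarrow> bool" where
  "spanning B f \<longleftrightarrow> finite B \<and> B \<in> U \<and> 4 \<le> card B \<and> graded_on f 0 (card B) \<and>
     f ` {0..card B} \<subseteq> Pow B \<and> gaps_in {B} (f ` {0..card B})"

abbreviation span :: "(nat \<Rightarrow> 'a set) \<Rightarrow> 'a set \<Rightarrow> 'a set set" where
  "span f B \<equiv> f ` {0..card B}"

text \<open>Subsets of \<open>B\<close> that differ by all of \<open>B\<close> are the empty set and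
  \<open>B\<close> itself; their sizes give the two indices.\<close>

lemma spanning_gap:
  assumes "spanning B f" "i \<le> card B" "i' \<le> card B" "f i \<subseteq> f i'" "f i' - f i \<in> U"
  shows "i = i' \<or> i = 0 \<and> i' = card B"
proof -
  have f: "graded_on f 0 (card B)" "gaps_in {B} (f ` {0..card B})" "f ` {0..card B} \<subseteq> Pow B" "finite B"
    using assms(1) by (auto simp: spanning_def)
  have *: "f i \<subseteq> B" "f i' \<subseteq> B" using f(3) assms(2,3) by (simp_all add: image_subset_iff)
  have "f i = f i' \<or> f i' - f i = B" using gaps_inD[OF f(2) _ _ assms(4,5)] assms(2,3) by auto
  then have "f i = f i' \<or> f i = {} \<and> f i' = B" using * by blast
  then show ?thesis using graded_on_card[OF f(1)] assms(2,3) by (metis atLeastAtMost_iff card.empty zero_le)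
qed

text \<open>The only possible difference uses both ends of the chain, so cutting off either end
  removes it.\<close>

lemma spanning_gap_free:
  assumes "spanning B f" "0 < a \<or> b < card B" "b \<le> card B"
  shows "gap_free (f ` {a..b})"
  unfolding gaps_in_def
proof (intro ballI impI)
  fix x y assume "x \<in> f ` {a..b}" "y \<in> f ` {a..b}" and xy: "x \<subset> y \<and> y - x \<in> U"
  then obtain i j where "i \<in> {a..b}" "j \<in> {a..b}" "x = f i" "y = f j" by blast
  then show "y - x \<in> {}" using spanning_gap[OF assms(1), of i j] xy assms(2,3) by auto
qed

lemma spanningD:
  assumes "spanning B f"
  shows "finite B" "B \<in> U" "4 \<le> card B" "graded_on f 0 (card B)" "span f B \<subseteq> Pow B"
  using assms by (auto simp: spanning_def)

text \<open>Translates the question into coordinates: by \<open>gap_split\<close> and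
  \<open>spanning_gap\<close> only pairs within one column, or from column 0 to the last column,
  need to be examined.\<close>

lemma gaps_in_cell:
  assumes "hooks f g (card B) c d B G" "spanning B f" "G \<in> U" "K \<subseteq> {0..card B} \<times> {c..d}"
    and gap: "\<And>i j i' j'. (i, j) \<in> K \<Longrightarrow> (i', j') \<in> K \<Longrightarrow> i = i' \<or> i = 0 \<and> i' = card B \<Longrightarrow>
      g j \<subseteq> g j' \<Longrightarrow> g j' - g j \<in> U \<Longrightarrow> f i \<union> g j \<subset> f i' \<union> g j' \<Longrightarrow>
      (f i' \<union> g j') - (f i \<union> g j) \<in> W"
  shows "gaps_in W ((\<lambda>(i, j). f i \<union> g j) ` K)"
  unfolding gaps_in_def
proof (intro ballI impI)
  interpret hooks f g "card B" c d B G by fact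
  fix x y assume "x \<in> cell ` K" "y \<in> cell ` K" and xy: "x \<subset> y \<and> y - x \<in> U"
  then obtain i j i' j' where *: "(i, j) \<in> K" "x = f i \<union> g j" "(i', j') \<in> K" "y = f i' \<union> g j'" by auto
  then have m: "i \<le> card B" "j \<in> {c..d}" "i' \<le> card B" "j' \<in> {c..d}" using assms(4) by auto
  then have "f i \<subseteq> B" "f i' \<subseteq> B" "g j \<subseteq> G" "g j' \<subseteq> G" using fB gG by (simp_all add: image_subset_iff)
  then have "f i \<subseteq> f i' \<and> f i' - f i \<in> U \<and> g j \<subseteq> g j' \<and> g j' - g j \<in> U"
    using gap_split[of "f i" B "f i'" "g j" G "g j'"] BG assms(3) spanningD(2)[OF assms(2)] xy *
    by blast
  then show "y - x \<in> W"
    using gap[OF *(1,3)] spanning_gap[OF assms(2) m(1,3)] xy * by blast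
qed

section \<open>Decompositions with controlled differences\<close>

text \<open>
  The hooks absorb one spanning chain each and are again gap-free with at least three elements, so they
  can replace \<open>X\<close> in the induction. On the remaining subgrid the truncated spanning chain, now gap-free,
  takes over the role of \<open>X\<close>; this is where blocks of size at least 4 are needed.
\<close>

lemma decomposable_gap_free:
  assumes "finite I" and "\<And>i. i \<in> I \<Longrightarrow> spanning (B i) (f i)"
    and "\<And>i j. i \<in> I \<Longrightarrow> j \<in> I \<Longrightarrow> i \<noteq> j \<Longrightarrow> B i \<inter> B j = {}"
    and "saturated_chain X c d" "c + 2 \<le> d" "X \<subseteq> Pow G" "G \<in> U" "gap_free X"
    and "decomposable (\<lambda>_. True) e Y" "Y \<subseteq> Pow H" "H \<in> U" "gap_free Y"
    and "G \<inter> H = {}" "\<And>i. i \<in> I \<Longrightarrow> B i \<inter> (G \<union> H) = {}"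
  shows "decomposable gap_free (c + d + e + (\<Sum>i\<in>I. card (B i)))
    (set_join (join_on I (\<lambda>i. span (f i) (B i))) (set_join X Y))"
  using assms
proof (induction I arbitrary: X c d G e Y H)
  case empty
  \<comment> \<open>With no full chain left, the product as a whole is gap-free, and any symmetric
    decomposition of it will do.\<close>
  have "decomposable (\<lambda>_. True) (c + d) X"
    by (rule decomposable_chain[OF empty(3)]) auto
  then have "decomposable (\<lambda>_. True) (c + d + e) (set_join X Y)"
    using empty by (intro decomposable_set_join)
  moreover have "gap_free (set_join X Y)" using empty by (intro gap_free_set_join)
  ultimately show ?case using gaps_in_subset by (auto intro: decomposable_mono)
next
  case (insert i I)
  let ?B = "B i" and ?f = "f i" and ?t = "card (B i)"
  let ?P = "join_on I (\<lambda>i. span (f i) (B i))" and ?F = "\<Union> (B ` I)"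
  let ?e = "c + d + e + (?t + (\<Sum>i\<in>I. card (B i)))"
  note B = spanningD[OF insert.prems(1)]
  have Bi: "spanning ?B ?f" using insert.prems(1) by simp
  have IH: "decomposable gap_free (c + d + e + (\<Sum>i\<in>I. card (B i))) (set_join ?P (set_join X Y))"
    if "saturated_chain X c d" "c + 2 \<le> d" "X \<subseteq> Pow G" "G \<in> U" "gap_free X"
    "decomposable (\<lambda>_. True) e Y" "Y \<subseteq> Pow H" "H \<in> U" "gap_free Y"
    "G \<inter> H = {}" "\<And>i. i \<in> I \<Longrightarrow> B i \<inter> (G \<union> H) = {}" for X c d G e Y H
    by (rule insert.IH[OF _ _ that]) (use insert.prems(1,2) in auto)
  obtain g where g: "graded_on g c d" and Xg: "X = g ` {c..d}"
    using insert.prems(3) unfolding saturated_chain_def by blast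
  have BGH: "?B \<inter> G = {}" "?B \<inter> H = {}" using insert.prems(13)[of i] by auto
  have BI: "?B \<inter> B l = {}" if "l \<in> I" for l using insert.prems(2)[of i l] insert.hyps(2) that by auto
  have G: "B l \<inter> G = {}" "B l \<inter> H = {}" if "l \<in> I" for l using insert.prems(13)[of l] that by auto
  interpret hooks ?f g ?t c d ?B G
    by unfold_locales (use B g BGH insert.prems(4,5) Xg in auto)
  have gap: "j = j'" if "j \<in> {c..d}" "j' \<in> {c..d}" "g j \<subseteq> g j'" "g j' - g j \<in> U" for j j'
    using gaps_inD[OF insert.prems(7), of "g j" "g j'"] that graded_on_inj[OF g] Xg by blast
  \<comment> \<open>As \<open>g\<close> has no gaps, a gap along a hook stays in one row
    \<open>j\<close>, and then it leads from \<open>(0, j)\<close> to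
    \<open>(?t, j)\<close>.\<close>
  have free: "gap_free (cell ` outer_hook ?t c d)" "gap_free (cell ` inner_hook ?t c d)"
  proof -
    have "gap_free (cell ` K)"
      if K: "K \<subseteq> {0..?t} \<times> {c..d}" "\<And>j. (0, j) \<in> K \<Longrightarrow> (?t, j) \<notin> K" for K
    proof (rule gaps_in_cell[OF hooks_axioms Bi insert.prems(6) K(1)])
      fix i' j i'' j'
      assume *: "(i', j) \<in> K" "(i'', j') \<in> K" "i' = i'' \<or> i' = 0 \<and> i'' = ?t"
        "g j \<subseteq> g j'" "g j' - g j \<in> U" "f i i' \<union> g j \<subset> f i i'' \<union> g j'"
      have "j = j'" by (rule gap) (use * K(1) in auto)
      then have "i' = i''" using * K(2) by blast
      then show "f i i'' \<union> g j' - (f i i' \<union> g j) \<in> {}" using \<open>j = j'\<close> * by blast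
    qed
    \<comment> \<open>Column 0 of the outer hook is the single point \<open>(0, c)\<close>, while
      its last column starts at \<open>d - 1\<close>, which exceeds \<open>c\<close>.\<close>
    moreover have "(?t, j) \<notin> outer_hook ?t c d" if "(0, j) \<in> outer_hook ?t c d" for j
      using that t cd by (auto simp: outer_hook_def)
    moreover have "(?t, j) \<notin> inner_hook ?t c d" for j
      using t by (auto simp: inner_hook_def)
    ultimately show "gap_free (cell ` outer_hook ?t c d)" "gap_free (cell ` inner_hook ?t c d)"
      using hooks_subset by blast+
  qed
  have sub: "cell ` outer_hook ?t c d \<subseteq> Pow (?B \<union> G)" "cell ` inner_hook ?t c d \<subseteq> Pow (?B \<union> G)"
    using set_join_subset_Pow[OF fB gG] unfolding grid_split by auto
  have merged: "?B \<union> G \<in> U" "(?B \<union> G) \<inter> H = {}"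
    "\<And>l. l \<in> I \<Longrightarrow> B l \<inter> (?B \<union> G \<union> H) = {}"
    "\<And>l. l \<in> I \<Longrightarrow> B l \<inter> (?B \<union> (G \<union> H)) = {}" "?B \<inter> (G \<union> H) = {}"
  proof -
    show "?B \<union> G \<in> U" using B(2) insert.prems(6) by (intro Un_closed) simp_all
    show "(?B \<union> G) \<inter> H = {}" "?B \<inter> (G \<union> H) = {}" using BGH insert.prems(12) by (simp_all add: Int_Un_distrib Int_Un_distrib2)
    show "B l \<inter> (?B \<union> G \<union> H) = {}" "B l \<inter> (?B \<union> (G \<union> H)) = {}" if "l \<in> I" for l
      using BI[OF that] G[OF that]
      by (simp_all add: Int_Un_distrib Int_commute)
  qed
  have P: "?P \<subseteq> Pow ?F" by (rule join_on_subset_Pow) (use insert.prems(1) spanningD(5) in auto)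
  have "decomposable gap_free ?e
    (set_join ?P (set_join (set_join (span ?f ?B) (g ` {c..d})) Y))"
  proof (rule decomposable_hooks[OF P _ insert.prems(9)])
    show "?F \<inter> (?B \<union> G) = {}" using BI G by blast
    show "H \<inter> (?B \<union> G \<union> ?F) = {}" using BGH G insert.prems(12) by blast
    have "decomposable gap_free (c + (?t + d) + e + (\<Sum>i\<in>I. card (B i)))
      (set_join ?P (set_join (cell ` outer_hook ?t c d) Y))"
      by (rule IH[OF saturated_chain_outer _ sub(1) merged(1) free(1) insert.prems(8-11) merged(2,3)])
        (use cd t in simp_all)
    then show "decomposable gap_free ?e (set_join ?P (set_join (cell ` outer_hook ?t c d) Y))"
      by (simp add: ac_simps)
    have "decomposable gap_free (c + 1 + (?t + d - 1) + e + (\<Sum>i\<in>I. card (B i)))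
      (set_join ?P (set_join (cell ` inner_hook ?t c d) Y))"
      by (rule IH[OF saturated_chain_inner _ sub(2) merged(1) free(2) insert.prems(8-11) merged(2,3)])
        (use cd t in simp_all)
    then show "decomposable gap_free ?e (set_join ?P (set_join (cell ` inner_hook ?t c d) Y))"
      using cd by (simp add: ac_simps)
    let ?X = "?f ` {2..?t}" and ?N = "g ` {c..d - 2}"
    have X: "saturated_chain ?X 2 ?t" "?X \<subseteq> Pow ?B" "gap_free ?X"
    proof -
      show "saturated_chain ?X 2 ?t"
        by (rule saturated_chain_image[OF graded_on_subset[OF f]]) (use t in auto)
      show "?X \<subseteq> Pow ?B" by (rule order_trans[OF image_mono fB]) auto
      show "gap_free ?X" by (rule spanning_gap_free[OF Bi]) auto
    qed
    have N: "saturated_chain ?N c (d - 2)" "?N \<subseteq> Pow G" "gap_free ?N"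
    proof -
      show "saturated_chain ?N c (d - 2)"
        by (rule saturated_chain_image[OF graded_on_subset[OF g]]) (use cd in auto)
      show "?N \<subseteq> Pow G" by (rule order_trans[OF image_mono gG]) auto
      show "gap_free ?N" by (rule gaps_in_subset[OF insert.prems(7)]) (auto simp: Xg)
    qed
    have "decomposable gap_free (2 + ?t + (c + (d - 2) + e) + (\<Sum>i\<in>I. card (B i)))
      (set_join ?P (set_join ?X (set_join ?N Y)))"
    proof (rule IH[OF X(1) _ X(2) B(2) X(3)])
      show "decomposable (\<lambda>_. True) (c + (d - 2) + e) (set_join ?N Y)"
        by (rule decomposable_set_join[OF _ insert.prems(8) N(2) insert.prems(9,12)])
          (auto intro: decomposable_chain[OF N(1)])
      show "set_join ?N Y \<subseteq> Pow (G \<union> H)" by (rule set_join_subset_Pow[OF N(2) insert.prems(9)])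
      show "G \<union> H \<in> U" using insert.prems(6,10) by (rule Un_closed)
      show "gap_free (set_join ?N Y)"
        by (rule gap_free_set_join[OF N(2) insert.prems(9,12,6,10) N(3) insert.prems(11)])
    qed (use merged(4,5) t in simp_all)
    moreover have "2 + ?t + (c + (d - 2) + e) + (\<Sum>i\<in>I. card (B i)) = ?e" using cd by simp
    ultimately show "decomposable gap_free ?e (set_join ?P (set_join ?X (set_join ?N Y)))"
      by (simp only:)
  qed
  then show ?case
    using insert.hyps by (simp add: join_on_insert set_join_assoc set_join_left_commute Xg)
qed

text \<open>
  Here the outer hook is itself a spanning chain for the merged block \<open>B i \<union> G\<close> and continues the
  induction; everything else is handled by the gap-free case.
\<close>

lemma decomposable_spanning:
  assumes "finite I" and "\<And>i. i \<in> I \<Longrightarrow> spanning (B i) (f i)"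
    and "\<And>i j. i \<in> I \<Longrightarrow> j \<in> I \<Longrightarrow> i \<noteq> j \<Longrightarrow> B i \<inter> B j = {}"
    and "spanning G g" "w \<subseteq> H" "decomposable (\<lambda>_. True) e {w}" "H \<in> U"
    and "G \<inter> H = {}" "\<And>i. i \<in> I \<Longrightarrow> B i \<inter> (G \<union> H) = {}"
  shows "decomposable (gaps_in {\<Union> (B ` I) \<union> G}) (card G + e + (\<Sum>i\<in>I. card (B i)))
    (set_join (join_on I (\<lambda>i. span (f i) (B i))) (set_join (span g G) {w}))"
  using assms
proof (induction I arbitrary: G g)
  case empty
  note G = spanningD[OF empty(3)]
  have "saturated_chain (span g G) 0 (card G)"
    using G(4) unfolding saturated_chain_def by blast
  then have "decomposable (\<lambda>_. True) (card G) (span g G)"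
    by (rule decomposable_chain) auto
  then have "decomposable (\<lambda>_. True) (card G + e) (set_join (span g G) {w})"
    by (rule decomposable_set_join[OF _ empty(5) G(5)]) (use empty(4,7) in auto)
  moreover have "gaps_in {G} (set_join (span g G) {w})"
    using empty(3,4,6,7) G(2,5) by (intro gaps_in_set_join[where G = G and H = H]) (auto simp: spanning_def)
  ultimately show ?case using gaps_in_subset by (auto intro: decomposable_mono)
next
  case (insert i I)
  let ?B = "B i" and ?f = "f i" and ?t = "card (B i)" and ?s = "card G"
  let ?P = "join_on I (\<lambda>i. span (f i) (B i))" and ?F = "\<Union> (B ` I)"
  let ?e = "?s + e + (?t + (\<Sum>i\<in>I. card (B i)))"
  let ?Q = "gaps_in {\<Union> (B ` insert i I) \<union> G}"
  note B = spanningD[OF insert.prems(1)] and G = spanningD[OF insert.prems(3)]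
  have Bi: "spanning ?B ?f" using insert.prems(1) by simp
  have BGH: "?B \<inter> G = {}" "?B \<inter> H = {}" using insert.prems(8)[of i] by auto
  have BI: "?B \<inter> B l = {}" if "l \<in> I" for l using insert.prems(2)[of i l] insert.hyps(2) that by auto
  have GI: "B l \<inter> G = {}" "B l \<inter> H = {}" if "l \<in> I" for l using insert.prems(8)[of l] that by auto
  interpret hooks ?f g ?t 0 ?s ?B G
    by unfold_locales (use B G BGH in auto)
  have w: "decomposable (\<lambda>_. True) e {w}" "{w} \<subseteq> Pow H" "gap_free {w}"
    using insert.prems(4,5) by (auto simp: gaps_in_def)
  have merged: "?B \<union> G \<in> U" "(?B \<union> G) \<inter> H = {}"
    "\<And>l. l \<in> I \<Longrightarrow> B l \<inter> (?B \<union> G \<union> H) = {}"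
    "\<And>l. l \<in> I \<Longrightarrow> B l \<inter> (?B \<union> (G \<union> H)) = {}" "?B \<inter> (G \<union> H) = {}"
  proof -
    show "?B \<union> G \<in> U" using B(2) G(2) by (intro Un_closed) simp_all
    show "(?B \<union> G) \<inter> H = {}" "?B \<inter> (G \<union> H) = {}" using BGH insert.prems(7) by (simp_all add: Int_Un_distrib Int_Un_distrib2)
    show "B l \<inter> (?B \<union> G \<union> H) = {}" "B l \<inter> (?B \<union> (G \<union> H)) = {}" if "l \<in> I" for l
      using BI[OF that] GI[OF that]
      by (simp_all add: Int_Un_distrib Int_commute)
  qed
  have P: "?P \<subseteq> Pow ?F" by (rule join_on_subset_Pow) (use insert.prems(1) spanningD(5) in auto)
  have sub: "cell ` outer_hook ?t 0 ?s \<subseteq> Pow (?B \<union> G)" "cell ` inner_hook ?t 0 ?s \<subseteq> Pow (?B \<union> G)"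
    using set_join_subset_Pow[OF fB gG] unfolding grid_split by auto
  have ends: "f i 0 = {}" "f i ?t = ?B" "g 0 = {}" "g ?s = G"
  proof -
    have "f i ?t \<subseteq> ?B" "g ?s \<subseteq> G"
      using spanningD(5)[OF Bi] G(5) by (simp_all add: image_subset_iff)
    moreover have "card (f i ?t) = ?t" "card (g ?s) = ?s"
      using graded_on_card[OF f] graded_on_card[OF g] by auto
    ultimately show "f i ?t = ?B" "g ?s = G" using spanningD(1)[OF Bi] G(1)
      by (simp_all add: card_subset_eq)
    show "f i 0 = {}" "g 0 = {}"
      using graded_on_card[OF f, of 0] graded_on_card[OF g, of 0]
        graded_on_finite[OF f, of 0] graded_on_finite[OF g, of 0] by auto
  qed
  have card: "card (?B \<union> G) = ?t + ?s" using B(1) G(1) BGH by (simp add: card_Un_disjoint)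
  have "gaps_in {?B \<union> G} (cell ` outer_hook ?t 0 ?s)"
  proof (rule gaps_in_cell[OF hooks_axioms Bi G(2) hooks_subset(1)])
    fix i' j i'' j'
    assume *: "(i', j) \<in> outer_hook ?t 0 ?s" "(i'', j') \<in> outer_hook ?t 0 ?s"
      "i' = i'' \<or> i' = 0 \<and> i'' = ?t" "g j \<subseteq> g j'" "g j' - g j \<in> U"
      "f i i' \<union> g j \<subset> f i i'' \<union> g j'"
    have "j \<le> ?s" "j' \<le> ?s" using * hooks_subset(1) by auto
    then have "j = j' \<or> j = 0 \<and> j' = ?s" using spanning_gap[OF insert.prems(3)] * by blast
    moreover have "\<not> (i' = i'' \<and> j = j')" using * by blast
    \<comment> \<open>No column of the outer hook meets both row 0 and row \<open>?s\<close>, and no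
      row of it meets both column 0 and column \<open>?t\<close>. Only the pair of opposite corners
      survives.\<close>
    ultimately have "i' = 0 \<and> i'' = ?t \<and> j = 0 \<and> j' = ?s"
      using *(1-3) t cd by (auto simp: outer_hook_def)
    then show "f i i'' \<union> g j' - (f i i' \<union> g j) \<in> {?B \<union> G}" using ends by simp
  qed
  moreover obtain h where h: "graded_on h 0 (?t + ?s)" "cell ` outer_hook ?t 0 ?s = h ` {0..?t + ?s}"
    using saturated_chain_outer unfolding saturated_chain_def by blast
  ultimately have outer: "spanning (?B \<union> G) h"
    using B(1,2) G(1,2) sub(1) t by (simp add: spanning_def card Un_closed)
  have inner: "gap_free (cell ` inner_hook ?t 0 ?s)"
  proof (rule gaps_in_cell[OF hooks_axioms Bi G(2) hooks_subset(2)])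
    fix i' j i'' j'
    assume *: "(i', j) \<in> inner_hook ?t 0 ?s" "(i'', j') \<in> inner_hook ?t 0 ?s"
      "i' = i'' \<or> i' = 0 \<and> i'' = ?t" "g j \<subseteq> g j'" "g j' - g j \<in> U"
      "f i i' \<union> g j \<subset> f i i'' \<union> g j'"
    have "j \<le> ?s" "j' \<le> ?s" using * hooks_subset(2) by auto
    then have "j = j' \<or> j = 0 \<and> j' = ?s" using spanning_gap[OF insert.prems(3)] * by blast
    moreover have "\<not> (i' = i'' \<and> j = j')" using * by blast
    \<comment> \<open>The inner hook avoids row 0 and column \<open>?t\<close>, so neither
      coordinate can make its full jump.\<close>
    ultimately show "f i i'' \<union> g j' - (f i i' \<union> g j) \<in> {}"
      using *(1-3) t cd by (auto simp: inner_hook_def)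
  qed
  have mono: "decomposable ?Q c X" if "decomposable gap_free c X" for c X
    by (rule decomposable_mono[OF that]) (auto intro: gaps_in_mono)
  have "decomposable ?Q ?e (set_join ?P (set_join (set_join (span ?f ?B) (span g G)) {w}))"
  proof (rule decomposable_hooks[OF P _ w(2)])
    show "?F \<inter> (?B \<union> G) = {}" using BI GI by blast
    show "H \<inter> (?B \<union> G \<union> ?F) = {}" using BGH GI insert.prems(7) by blast
    have "decomposable (gaps_in {?F \<union> (?B \<union> G)}) (card (?B \<union> G) + e + (\<Sum>i\<in>I. card (B i)))
      (set_join ?P (set_join (span h (?B \<union> G)) {w}))"
      by (rule insert.IH[OF _ _ outer insert.prems(4-6) merged(2,3)])
        (use insert.prems(1,2) in simp_all)
    moreover have "?F \<union> (?B \<union> G) = \<Union> (B ` insert i I) \<union> G" by auto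
    moreover have "?t + ?s + e + (\<Sum>i\<in>I. card (B i)) = ?e" by simp
    ultimately show "decomposable ?Q ?e (set_join ?P (set_join (cell ` outer_hook ?t 0 ?s) {w}))"
      by (simp only: card h(2))
    have "decomposable gap_free (0 + 1 + (?t + ?s - 1) + e + (\<Sum>i\<in>I. card (B i)))
      (set_join ?P (set_join (cell ` inner_hook ?t 0 ?s) {w}))"
      by (rule decomposable_gap_free[OF insert.hyps(1) _ _ saturated_chain_inner _ sub(2) merged(1) inner
            w(1,2) insert.prems(6) w(3) merged(2,3)]) (use insert.prems(1,2) cd t in simp_all)
    then show "decomposable ?Q ?e (set_join ?P (set_join (cell ` inner_hook ?t 0 ?s) {w}))"
      using cd by (intro mono) (simp add: ac_simps)
    let ?X = "?f ` {2..?t}" and ?N = "g ` {0..?s - 2}"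
    have X: "saturated_chain ?X 2 ?t" "?X \<subseteq> Pow ?B" "gap_free ?X"
    proof -
      show "saturated_chain ?X 2 ?t"
        by (rule saturated_chain_image[OF graded_on_subset[OF f]]) (use t in auto)
      show "?X \<subseteq> Pow ?B" by (rule order_trans[OF image_mono fB]) auto
      show "gap_free ?X" by (rule spanning_gap_free[OF Bi]) auto
    qed
    have N: "saturated_chain ?N 0 (?s - 2)" "?N \<subseteq> Pow G" "gap_free ?N"
    proof -
      show "saturated_chain ?N 0 (?s - 2)"
        by (rule saturated_chain_image[OF graded_on_subset[OF g]]) (use cd in auto)
      show "?N \<subseteq> Pow G" by (rule order_trans[OF image_mono gG]) auto
      show "gap_free ?N" by (rule spanning_gap_free[OF insert.prems(3)]) (use cd in auto)
    qed
    have "decomposable gap_free (2 + ?t + (0 + (?s - 2) + e) + (\<Sum>i\<in>I. card (B i)))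
      (set_join ?P (set_join ?X (set_join ?N {w})))"
    proof (rule decomposable_gap_free[OF insert.hyps(1) _ _ X(1) _ X(2) B(2) X(3)])
      show "decomposable (\<lambda>_. True) (0 + (?s - 2) + e) (set_join ?N {w})"
        by (rule decomposable_set_join[OF _ w(1) N(2) w(2) insert.prems(7)])
          (auto intro: decomposable_chain[OF N(1)])
      show "set_join ?N {w} \<subseteq> Pow (G \<union> H)" by (rule set_join_subset_Pow[OF N(2) w(2)])
      show "G \<union> H \<in> U" using G(2) insert.prems(6) by (rule Un_closed)
      show "gap_free (set_join ?N {w})"
        by (rule gap_free_set_join[OF N(2) w(2) insert.prems(7) G(2) insert.prems(6) N(3) w(3)])
    qed (use merged(4,5) t insert.prems(1,2) in simp_all)
    moreover have "2 + ?t + (0 + (?s - 2) + e) + (\<Sum>i\<in>I. card (B i)) = ?e" using cd by simp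
    ultimately show "decomposable ?Q ?e (set_join ?P (set_join ?X (set_join ?N {w})))"
      by (intro mono) (simp only:)
  qed
  then show ?case
    using insert.hyps by (simp add: join_on_insert set_join_assoc set_join_left_commute)
qed

end

section \<open>Decomposing one cuboid\<close>

lemma saturated_chain_card: "saturated_chain C a b \<Longrightarrow> x \<in> C \<Longrightarrow> finite x \<and> card x \<in> {a..b}"
  unfolding saturated_chain_def by (auto dest: graded_on_card graded_on_finite)

lemma join_on_Int:
  assumes "z \<in> join_on I X" "\<And>i. i \<in> I \<Longrightarrow> X i \<subseteq> Pow (B i)"
    and "\<And>i j. i \<in> I \<Longrightarrow> j \<in> I \<Longrightarrow> i \<noteq> j \<Longrightarrow> B i \<inter> B j = {}" and "i \<in> I"
  shows "z \<inter> B i \<in> X i"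
proof -
  obtain s where s: "z = \<Union> (s ` I)" "\<forall>i\<in>I. s i \<in> X i" using assms(1) unfolding join_on_def by blast
  have "s l \<subseteq> B l" if "l \<in> I" for l using s assms(2) that by blast
  then have "z \<inter> B i = s i" using s(1) assms(3,4) by blast
  then show ?thesis using s assms(4) by simp
qed

text \<open>Within a single block the only nonempty union of blocks is the block itself. So a factor
  can have a gap only if it contains the empty set, that is, if \<open>a i = 0\<close>; every other
  factor is gap-free. The cases depend on whether some gap-free factor has more than one
  member.\<close>

lemma decomposable_block_product:
  fixes B :: "'i \<Rightarrow> 'a set"
  assumes "finite I" and "\<And>i. i \<in> I \<Longrightarrow> 4 \<le> card (B i)" and "\<And>i. i \<in> I \<Longrightarrow> even (card (B i))"
    and X: "\<And>i. i \<in> I \<Longrightarrow> X i \<subseteq> Pow (B i)"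
    and ch: "\<And>i. i \<in> I \<Longrightarrow> saturated_chain (X i) (a i) (b i)"
    and ab: "\<And>i. i \<in> I \<Longrightarrow> a i + b i = card (B i)"
    and disj: "\<And>i j. i \<in> I \<Longrightarrow> j \<in> I \<Longrightarrow> i \<noteq> j \<Longrightarrow> B i \<inter> B j = {}"
  shows "decomposable (\<lambda>C. \<forall>x\<in>C. \<forall>y\<in>C. x \<subset> y \<and> (\<exists>S\<subseteq>I. y - x = \<Union> (B ` S)) \<longrightarrow>
      (\<forall>i\<in>I. B i \<subseteq> y - x \<or> card (X i) = 1)) (\<Sum>i\<in>I. card (B i)) (join_on I X)"
    (is "decomposable ?P ?e _")
proof -
  have same: "s = t" if "s \<in> S" "t \<in> T" "x \<in> B s" "x \<in> B t" "S \<subseteq> I" "T \<subseteq> I" for s t S T x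
    using disj[of s t] that by blast
  define U where "U = {\<Union> (B ` S) | S. S \<subseteq> I}"
  have BU: "\<Union> (B ` S) \<in> U" if "S \<subseteq> I" for S using that unfolding U_def by blast
  interpret block_algebra U
  proof
    fix u v assume "u \<in> U" "v \<in> U"
    then obtain S T where ST: "S \<subseteq> I" "T \<subseteq> I" "u = \<Union> (B ` S)" "v = \<Union> (B ` T)" unfolding U_def by blast
    have "u \<union> v = \<Union> (B ` (S \<union> T))" using ST(3,4) by blast
    then show "u \<union> v \<in> U" using BU[of "S \<union> T"] ST(1,2) by simp
    have "u \<inter> v = \<Union> (B ` (S \<inter> T))" using ST(3,4) same[OF _ _ _ _ ST(1,2)] by blast
    then show "u \<inter> v \<in> U" using BU[of "S \<inter> T"] ST(1) by (metis le_infI1)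
  next
    show "{} \<in> U" using BU[of "{}"] by simp
  qed
  have BU1: "B i \<in> U" if "i \<in> I" for i using BU[of "{i}"] that by simp
  have Bfin: "finite (B i)" if "i \<in> I" for i using assms(2)[OF that] by (intro card_ge_0_finite) linarith
  have disjU: "\<Union> (B ` S) \<inter> \<Union> (B ` T) = {}" if "S \<subseteq> I" "T \<subseteq> I" "S \<inter> T = {}" for S T
    using that(3) same[OF _ _ _ _ that(1,2)] by blast
  have atom: "u = {} \<or> u = B i" if "i \<in> I" "u \<in> U" "u \<subseteq> B i" for u i
  proof (cases "u = {}")
    case False
    then obtain S l where S: "S \<subseteq> I" "u = \<Union> (B ` S)" "l \<in> S" "B l \<noteq> {}"
      using \<open>u \<in> U\<close> unfolding U_def by auto
    then have "B l \<subseteq> B i" using that(3) by blast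
    then have "l = i" using disj[of l i] S that(1) by blast
    then show ?thesis using S that(3) by blast
  qed simp
  have gap: "gaps_in {B i} (X i)" if "i \<in> I" for i
    unfolding gaps_in_def
  proof (intro ballI impI)
    fix x y assume "x \<in> X i" "y \<in> X i" and xy: "x \<subset> y \<and> y - x \<in> U"
    then have "y - x \<subseteq> B i" "y - x \<noteq> {}" using X[OF that] by blast+
    then show "y - x \<in> {B i}" using atom[OF that] xy by blast
  qed
  \<comment> \<open>The indices of the full chains: \<open>a i = 0\<close> forces
    \<open>b i = card (B i)\<close>.\<close>
  define Z where "Z = {i \<in> I. a i = 0}"
  define R where "R = I - Z"
  have I: "I = Z \<union> R" "Z \<inter> R = {}" "Z \<subseteq> I" "R \<subseteq> I" by (auto simp: Z_def R_def)
  have fin: "finite Z" "finite R" using assms(1) I finite_subset by blast+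
  have "\<exists>f. spanning (B i) f \<and> X i = span f (B i)" if "i \<in> Z" for i
  proof -
    have i: "i \<in> I" "a i = 0" using that by (auto simp: Z_def)
    obtain f where "graded_on f 0 (card (B i))" "X i = span f (B i)"
      using ch[OF i(1)] ab[OF i(1)] i(2) unfolding saturated_chain_def by auto
    then show ?thesis
      using gap[OF i(1)] X[OF i(1)] assms(2)[OF i(1)] Bfin[OF i(1)] BU1[OF i(1)]
      by (auto simp: spanning_def)
  qed
  then obtain f where f: "\<And>i. i \<in> Z \<Longrightarrow> spanning (B i) (f i)" "\<And>i. i \<in> Z \<Longrightarrow> X i = span (f i) (B i)"
    by metis
  have free: "gap_free (X i)" if "i \<in> R" for i
    unfolding gaps_in_def
  proof (intro ballI impI)
    fix x y assume x: "x \<in> X i" and y: "y \<in> X i" and xy: "x \<subset> y \<and> y - x \<in> U"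
    have i: "i \<in> I" "a i \<noteq> 0" using that by (auto simp: Z_def R_def)
    have "y - x = B i" using gap[OF i(1)] x y xy unfolding gaps_in_def by blast
    then have "x = {}" using X[OF i(1)] x y by blast
    then show "y - x \<in> {}" using saturated_chain_card[OF ch[OF i(1)] x] i(2) by simp
  qed
  have freeJ: "gap_free (join_on J X)" if "finite J" "J \<subseteq> R" for J
    using that
  proof (induction J)
    case empty
    then show ?case by (simp add: gaps_in_def)
  next
    case (insert i J)
    have J: "i \<in> I" "J \<subseteq> I" using insert.prems I by auto
    have "gap_free (set_join (X i) (join_on J X))"
    proof (rule gap_free_set_join)
      show "join_on J X \<subseteq> Pow (\<Union> (B ` J))" by (rule join_on_subset_Pow) (use X J in auto)
      show "B i \<inter> \<Union> (B ` J) = {}" using disjU[of "{i}" J] J insert.hyps by auto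
    qed (use insert J X BU BU1 free in auto)
    then show ?case using insert.hyps by (simp add: join_on_insert)
  qed
  have dec: "decomposable (\<lambda>_. True) (\<Sum>i\<in>J. card (B i)) (join_on J X)" if "J \<subseteq> I" for J
  proof -
    have "decomposable (\<lambda>_. True) (\<Sum>i\<in>J. a i + b i) (join_on J X)"
      by (rule decomposable_join_on[where B = B, OF finite_subset[OF that assms(1)]])
        (simp_all add: ch X disj that[THEN subsetD])
    moreover have "(\<Sum>i\<in>J. a i + b i) = (\<Sum>i\<in>J. card (B i))" using ab that by (intro sum.cong) auto
    ultimately show ?thesis by simp
  qed
  have sum: "?e = (\<Sum>i\<in>Z. card (B i)) + (\<Sum>i\<in>R. card (B i))"
    using sum.union_disjoint[OF fin I(2)] I(1) by simp
  have JZ: "join_on J (\<lambda>i. span (f i) (B i)) = join_on J X" if "J \<subseteq> Z" for J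
    by (rule join_on_cong) (use f(2) that in auto)
  have split: "join_on I X = set_join (join_on Z X) (join_on R X)"
    using join_on_Un[OF I(2), of X] I(1) by simp
  show ?thesis
  proof (cases "\<exists>i\<in>R. a i < b i")
    case True
    then obtain i where i: "i \<in> R" "a i < b i" by blast
    have iI: "i \<in> I" using i I by auto
    \<comment> \<open>Evenness of the block turns \<open>a i < b i\<close> into a difference of at
      least two, the length that the hooks require.\<close>
    have "even (a i + b i)" using assms(3) ab iI by simp
    then have gap2: "a i + 2 \<le> b i" using i(2) by presburger
    let ?R = "R - {i}"
    have R: "R = insert i ?R" using i by auto
    \<comment> \<open>The longer factor \<open>X i\<close> is the distinguished chain; the other
      gap-free factors are multiplied together into the passive factor.\<close>
    have "decomposable gap_free (a i + b i + (\<Sum>i\<in>?R. card (B i)) + (\<Sum>i\<in>Z. card (B i)))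
       (set_join (join_on Z (\<lambda>i. span (f i) (B i))) (set_join (X i) (join_on ?R X)))"
    proof (rule decomposable_gap_free[OF fin(1) f(1) _ ch[OF iI] gap2 X[OF iI] BU1[OF iI] free[OF i(1)]])
      show "decomposable (\<lambda>_. True) (\<Sum>i\<in>?R. card (B i)) (join_on ?R X)" by (rule dec) (use I in auto)
      show "join_on ?R X \<subseteq> Pow (\<Union> (B ` ?R))" by (rule join_on_subset_Pow) (use X I in auto)
      show "\<Union> (B ` ?R) \<in> U" by (rule BU) (use I in auto)
      show "gap_free (join_on ?R X)" by (rule freeJ) (use fin in auto)
      show "B i \<inter> \<Union> (B ` ?R) = {}" using disjU[of "{i}" ?R] iI I by auto
      show "B l \<inter> (B i \<union> \<Union> (B ` ?R)) = {}" if "l \<in> Z" for l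
        using disjU[of "{l}" R] I that i by blast
    qed (use disj I in auto)
    moreover have "set_join (X i) (join_on ?R X) = join_on R X"
      using join_on_insert[of i ?R X] R by simp
    moreover have "a i + b i + (\<Sum>i\<in>?R. card (B i)) = (\<Sum>i\<in>R. card (B i))"
      using sum.remove[OF fin(2) i(1), of "\<lambda>i. card (B i)"] ab[OF iI] by simp
    ultimately have "decomposable gap_free ?e (join_on I X)"
      by (simp add: sum split JZ add.commute)
    then show ?thesis
    proof (rule decomposable_mono, intro ballI impI)
      fix C x y i
      assume C: "gap_free C" "x \<in> C" "y \<in> C"
        and xy: "x \<subset> y \<and> (\<exists>S\<subseteq>I. y - x = \<Union> (B ` S))"
      then have "y - x \<in> U" by (auto simp: U_def)
      then show "B i \<subseteq> y - x \<or> card (X i) = 1" using C xy unfolding gaps_in_def by simp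
    qed
  next
    case False
    have single: "\<exists>v. X i = {v}" if "i \<in> R" for i
    proof -
      have "i \<in> I" using that I by auto
      then have "a i = b i" using False that saturated_chain_le[OF ch] by (simp add: eq_iff not_less)
      then show ?thesis using ch[OF \<open>i \<in> I\<close>] unfolding saturated_chain_def by auto
    qed
    then obtain v where v: "\<And>i. i \<in> R \<Longrightarrow> X i = {v i}" by metis
    have w: "join_on R X = {\<Union> (v ` R)}"
    proof -
      have "join_on R X = join_on R (\<lambda>i. {v i})" by (rule join_on_cong) (rule v)
      also have "\<dots> = {\<Union> (v ` R)}" unfolding join_on_def by (auto intro: SUP_cong)
      finally show ?thesis .
    qed
    show ?thesis
    proof (cases "Z = {}")
      case True
      \<comment> \<open>Every factor is a singleton here, so the second alternative of the
        conclusion always holds.\<close>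
      then have "card (X i) = 1" if "i \<in> I" for i using v[of i] that I by simp
      then show ?thesis using dec[of I] by (auto intro: decomposable_mono)
    next
      case nonempty: False
      then obtain z where z: "z \<in> Z" by blast
      let ?Z = "Z - {z}"
      have zI: "z \<in> I" using z I by auto
      \<comment> \<open>Any full chain may start the merged block. The remaining full chains are
        absorbed one by one, and the singleton factors amount to one fixed set.\<close>
      have "decomposable (gaps_in {\<Union> (B ` ?Z) \<union> B z})
         (card (B z) + (\<Sum>i\<in>R. card (B i)) + (\<Sum>i\<in>?Z. card (B i)))
         (set_join (join_on ?Z (\<lambda>i. span (f i) (B i))) (set_join (span (f z) (B z)) {\<Union> (v ` R)}))"
      proof (rule decomposable_spanning[OF _ _ _ f(1)[OF z]])
        show "decomposable (\<lambda>_. True) (\<Sum>i\<in>R. card (B i)) {\<Union> (v ` R)}"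
          using dec[OF I(4)] w by simp
        have "join_on R X \<subseteq> Pow (\<Union> (B ` R))" by (rule join_on_subset_Pow) (use X I in auto)
        then show "\<Union> (v ` R) \<subseteq> \<Union> (B ` R)" using w by simp
        show "\<Union> (B ` R) \<in> U" by (rule BU) (use I in auto)
        show "B z \<inter> \<Union> (B ` R) = {}" using disjU[of "{z}" R] z I by auto
        show "B l \<inter> (B z \<union> \<Union> (B ` R)) = {}" if "l \<in> ?Z" for l
          using disjU[of "{l}" "insert z R"] I that zI by blast
      qed (use fin f disj I in auto)
      moreover have "\<Union> (B ` ?Z) \<union> B z = \<Union> (B ` Z)" using z by blast
      moreover have "set_join (join_on ?Z X) (set_join (X z) (join_on R X)) = join_on I X"
        using join_on_insert[of z ?Z X] z
        by (simp add: split insert_absorb set_join_assoc set_join_left_commute)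
      moreover have "card (B z) + (\<Sum>i\<in>R. card (B i)) + (\<Sum>i\<in>?Z. card (B i)) = ?e"
        using sum sum.remove[OF fin(1) z, of "\<lambda>i. card (B i)"] by simp
      ultimately have "decomposable (gaps_in {\<Union> (B ` Z)}) ?e (join_on I X)"
        using f(2)[OF z] by (simp add: JZ w)
      then show ?thesis
      proof (rule decomposable_mono, intro ballI impI)
        fix C x y i
        assume C: "gaps_in {\<Union> (B ` Z)} C" "x \<in> C" "y \<in> C" "i \<in> I"
          and xy: "x \<subset> y \<and> (\<exists>S\<subseteq>I. y - x = \<Union> (B ` S))"
        then have "y - x \<in> U" by (auto simp: U_def)
        then have "y - x = \<Union> (B ` Z)" using C xy unfolding gaps_in_def by simp
        \<comment> \<open>Blocks with a full chain lie inside the difference; all others carry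
          singletons.\<close>
        then show "B i \<subseteq> y - x \<or> card (X i) = 1" using v[of i] C(4) I(1) by auto
      qed
    qed
  qed
qed

section \<open>Orthogonality within and across decompositions\<close>

text \<open>The order-theoretic content of almost orthogonality. Without cardinalities it passes
  easily through injections and to products.\<close>

definition orthogonal_chains :: "'a set \<Rightarrow> 'a set set \<Rightarrow> 'a set set \<Rightarrow> bool" where
  "orthogonal_chains T C D \<longleftrightarrow> (\<forall>x\<in>C \<inter> D. \<forall>y\<in>C \<inter> D. x \<subset> y \<longrightarrow> x = {} \<and> y = T)"

lemma orthogonal_chainsD:
  "orthogonal_chains T C D \<Longrightarrow> x \<in> C \<Longrightarrow> x \<in> D \<Longrightarrow> y \<in> C \<Longrightarrow> y \<in> D \<Longrightarrow> x \<subset> y \<Longrightarrow> x = {} \<and> y = T"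
  unfolding orthogonal_chains_def by simp

lemma symmetric_chain_iff:
  "symmetric_chain n C \<longleftrightarrow> C \<subseteq> Pow {1..n} \<and> (\<exists>a b. a + b = n \<and> saturated_chain C a b)"
proof
  assume "symmetric_chain n C"
  then obtain j where C: "C \<subseteq> Pow {1..n}" "chain_subset C" and j: "2 * j \<le> n"
    "\<forall>S\<in>C. card S \<in> {j..n - j}" "\<forall>m\<in>{j..n - j}. \<exists>!S. S \<in> C \<and> card S = m"
    unfolding symmetric_chain_def boolean_lattice_def by blast
  have fin: "finite S" if "S \<in> C" for S using C(1) that finite_subset[of S "{1..n}"] by auto
  have "saturated_chain C j (n - j)"
  proof (rule saturated_chainI)
    fix x y assume xy: "x \<in> C" "y \<in> C" "card x \<le> card y"
    then have "x \<subseteq> y \<or> y \<subseteq> x" using C(2) unfolding chain_subset_def by blast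
    then show "x \<subseteq> y" using card_seteq[OF fin[OF xy(1)], of y] xy(3) by auto
  next
    fix i assume "i \<in> {j..n - j}"
    then show "\<exists>x\<in>C. card x = i" using j(3) by blast
  qed (use fin j in auto)
  moreover have "j + (n - j) = n" using j(1) by simp
  ultimately show "C \<subseteq> Pow {1..n} \<and> (\<exists>a b. a + b = n \<and> saturated_chain C a b)" using C(1) by blast
next
  assume "C \<subseteq> Pow {1..n} \<and> (\<exists>a b. a + b = n \<and> saturated_chain C a b)"
  then obtain a b f where C: "C \<subseteq> Pow {1..n}" "a + b = n" and f: "graded_on f a b" "C = f ` {a..b}"
    unfolding saturated_chain_def by blast
  have "a \<le> b" using f(1) by (rule graded_on_le)
  have "chain_subset C"
    unfolding chain_subset_def f(2) using graded_on_mono[OF f(1)] nat_le_linear by blast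
  moreover have "2 * a \<le> n \<and> (\<forall>S\<in>C. card S \<in> {a..n - a}) \<and>
      (\<forall>m\<in>{a..n - a}. \<exists>!S. S \<in> C \<and> card S = m)"
  proof (intro conjI)
    have b: "n - a = b" using C(2) by auto
    show "2 * a \<le> n" using C(2) \<open>a \<le> b\<close> by simp
    show "\<forall>S\<in>C. card S \<in> {a..n - a}" using graded_on_card[OF f(1)] by (auto simp: b f(2))
    show "\<forall>m\<in>{a..n - a}. \<exists>!S. S \<in> C \<and> card S = m"
      unfolding b f(2) using graded_on_card[OF f(1)] by auto
  qed
  ultimately show "symmetric_chain n C"
    using C(1) unfolding symmetric_chain_def boolean_lattice_def by blast
qed

lemma chain_comparable: "saturated_chain C a b \<Longrightarrow> x \<in> C \<Longrightarrow> y \<in> C \<Longrightarrow> x \<subseteq> y \<or> y \<subseteq> x"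
  unfolding saturated_chain_def using graded_on_mono nat_le_linear by blast

text \<open>Two distinct common members of two chains are comparable, hence form a pair to which
  \<open>orthogonal_chains\<close> applies. With \<open>0 < n\<close> the sets \<open>{}\<close> and
  \<open>{1..n}\<close> are distinct, so the exceptional intersection really has two
  members.\<close>

lemma almost_orthogonal_iff:
  assumes F: "\<And>A. A \<in> F \<Longrightarrow> symmetric_chain n A" and "0 < n"
  shows "almost_orthogonal n F G \<longleftrightarrow> (\<forall>A\<in>F. \<forall>B\<in>G. orthogonal_chains {1..n} A B)"
proof -
  have "(if {{}, {1..n}} \<subseteq> A \<and> {{}, {1..n}} \<subseteq> B then card (A \<inter> B) = 2 else card (A \<inter> B) \<le> 1) \<longleftrightarrow>
      orthogonal_chains {1..n} A B" (is "?L \<longleftrightarrow> ?R") if AB: "A \<in> F" "B \<in> G" for A B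
  proof
    obtain a b where A: "A \<subseteq> Pow {1..n}" "saturated_chain A a b"
      using F[OF AB(1)] unfolding symmetric_chain_iff by blast
    have fin: "finite (A \<inter> B)" using A(1) by (meson finite_Int finite_Pow_iff finite_atLeastAtMost finite_subset)
    have ne: "{} \<noteq> {1..n}" using assms(2) by simp
    show ?R if L: ?L
      unfolding orthogonal_chains_def
    proof (intro ballI impI)
      fix x y assume xy: "x \<in> A \<inter> B" "y \<in> A \<inter> B" "x \<subset> y"
      then have "card {x, y} \<le> card (A \<inter> B)" using fin by (intro card_mono) auto
      moreover have "card {x, y} = 2" using xy(3) by auto
      ultimately have T: "{{}, {1..n}} \<subseteq> A \<inter> B" "card (A \<inter> B) = 2" using L by (auto split: if_splits)
      then have "{{}, {1..n}} = A \<inter> B" using fin ne by (intro card_subset_eq) auto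
      then show "x = {} \<and> y = {1..n}" using xy by blast
    qed
    assume R: ?R
    show ?L
    proof (cases "{{}, {1..n}} \<subseteq> A \<and> {{}, {1..n}} \<subseteq> B")
      case True
      then have "z = {} \<or> z = {1..n}" if "z \<in> A \<inter> B" for z
        using orthogonal_chainsD[OF R, of "{}" z] True that by auto
      then have "A \<inter> B = {{}, {1..n}}" using True by blast
      then show ?thesis using True ne by simp
    next
      case False
      have "x = y" if "x \<in> A \<inter> B" "y \<in> A \<inter> B" for x y
        using chain_comparable[OF A(2), of x y] orthogonal_chainsD[OF R, of x y]
          orthogonal_chainsD[OF R, of y x] False that by auto
      then have "card (A \<inter> B) \<le> Suc 0" using fin by (auto simp: card_le_Suc0_iff_eq)
      then show ?thesis using False by auto
    qed
  qed
  then show ?thesis unfolding almost_orthogonal_def by blast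
qed

text \<open>A set \<open>z\<close> has the components \<open>z \<inter> B i\<close>, and each of
  them lies in exactly one class of its partition. Extensional functions are used so that distinct
  choices differ at an index of \<open>I\<close>.\<close>

lemma UN_join_on_PiE:
  assumes "\<And>i. i \<in> I \<Longrightarrow> partition_on (Pow (B i)) (P i)"
    and disj: "\<And>i j. i \<in> I \<Longrightarrow> j \<in> I \<Longrightarrow> i \<noteq> j \<Longrightarrow> B i \<inter> B j = {}"
  shows "(\<Union>A\<in>Pi\<^sub>E I P. join_on I A) = Pow (\<Union> (B ` I))"
    and "A \<in> Pi\<^sub>E I P \<Longrightarrow> A' \<in> Pi\<^sub>E I P \<Longrightarrow> A \<noteq> A' \<Longrightarrow> join_on I A \<inter> join_on I A' = {}"
proof -
  have sub: "C \<subseteq> Pow (B i)" if "i \<in> I" "C \<in> P i" for i C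
    using assms(1)[OF that(1)] that(2) unfolding partition_on_def by blast
  show "(\<Union>A\<in>Pi\<^sub>E I P. join_on I A) = Pow (\<Union> (B ` I))"
  proof (intro equalityI subsetI)
    fix z assume "z \<in> (\<Union>A\<in>Pi\<^sub>E I P. join_on I A)"
    then obtain A where A: "A \<in> Pi\<^sub>E I P" "z \<in> join_on I A" by blast
    have "join_on I A \<subseteq> Pow (\<Union> (B ` I))"
      by (rule join_on_subset_Pow) (use sub PiE_mem[OF A(1)] in blast)
    then show "z \<in> Pow (\<Union> (B ` I))" using A(2) by blast
  next
    fix z assume z: "z \<in> Pow (\<Union> (B ` I))"
    have "\<exists>C. C \<in> P i \<and> z \<inter> B i \<in> C" if "i \<in> I" for i
      using partition_onD1[OF assms(1)[OF that]] by blast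
    then obtain A where A: "\<And>i. i \<in> I \<Longrightarrow> A i \<in> P i \<and> z \<inter> B i \<in> A i" by metis
    have "restrict A I \<in> Pi\<^sub>E I P" using A by auto
    moreover have "z \<in> join_on I (restrict A I)"
    proof -
      have "z = \<Union> ((\<lambda>i. z \<inter> B i) ` I)" using z by blast
      moreover have "\<forall>i\<in>I. z \<inter> B i \<in> restrict A I i" using A by simp
      ultimately show ?thesis unfolding join_on_def mem_Collect_eq by (intro exI conjI)
    qed
    ultimately show "z \<in> (\<Union>A\<in>Pi\<^sub>E I P. join_on I A)" by blast
  qed
  assume A: "A \<in> Pi\<^sub>E I P" "A' \<in> Pi\<^sub>E I P" "A \<noteq> A'"
  show "join_on I A \<inter> join_on I A' = {}"
  proof (rule ccontr)
    assume "join_on I A \<inter> join_on I A' \<noteq> {}"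
    then obtain z where z: "z \<in> join_on I A" "z \<in> join_on I A'" by blast
    have "A i = A' i" if "i \<in> I" for i
    proof -
      have "z \<inter> B i \<in> A i" by (rule join_on_Int[OF z(1) sub disj that]) (use PiE_mem[OF A(1)] in auto)
      moreover have "z \<inter> B i \<in> A' i" by (rule join_on_Int[OF z(2) sub disj that]) (use PiE_mem[OF A(2)] in auto)
      moreover have "A i \<in> P i" "A' i \<in> P i" using PiE_mem[OF A(1) that] PiE_mem[OF A(2) that] by auto
      ultimately show ?thesis
        using assms(1)[OF that] unfolding partition_on_def disjoint_def by blast
    qed
    then show False using PiE_ext[OF A(1,2)] A(3) by blast
  qed
qed

lemma orthogonal_chains_join:
  assumes "C \<subseteq> join_on I A" "D \<subseteq> join_on I A'"
    and A: "\<And>i. i \<in> I \<Longrightarrow> A i \<subseteq> Pow (B i)" and A': "\<And>i. i \<in> I \<Longrightarrow> A' i \<subseteq> Pow (B i)"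
    and disj: "\<And>i j. i \<in> I \<Longrightarrow> j \<in> I \<Longrightarrow> i \<noteq> j \<Longrightarrow> B i \<inter> B j = {}"
    and orth: "\<And>i. i \<in> I \<Longrightarrow> orthogonal_chains (B i) (A i) (A' i)"
    and comp: "\<And>x y. x \<in> C \<Longrightarrow> y \<in> C \<Longrightarrow> x \<subset> y \<Longrightarrow> \<exists>S\<subseteq>I. y - x = \<Union> (B ` S) \<Longrightarrow>
      \<forall>i\<in>I. B i \<subseteq> y - x \<or> card (A i) = 1"
    and comp': "\<And>x y. x \<in> D \<Longrightarrow> y \<in> D \<Longrightarrow> x \<subset> y \<Longrightarrow> \<exists>S\<subseteq>I. y - x = \<Union> (B ` S) \<Longrightarrow>
      \<forall>i\<in>I. B i \<subseteq> y - x \<or> card (A' i) = 1"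
    and good: "\<And>i. i \<in> I \<Longrightarrow> A i = A' i \<Longrightarrow> card (A i) \<noteq> 1"
  shows "orthogonal_chains (\<Union> (B ` I)) C D"
  unfolding orthogonal_chains_def
proof (intro ballI impI)
  fix x y assume x: "x \<in> C \<inter> D" and y: "y \<in> C \<inter> D" and xy: "x \<subset> y"
  have comps: "z \<inter> B i \<in> A i" "z \<inter> B i \<in> A' i" if "z \<in> C \<inter> D" "i \<in> I" for z i
  proof -
    show "z \<inter> B i \<in> A i" by (rule join_on_Int[OF _ A disj that(2)]) (use assms(1) that(1) in auto)
    show "z \<inter> B i \<in> A' i" by (rule join_on_Int[OF _ A' disj that(2)]) (use assms(2) that(1) in auto)
  qed
  have y_sub: "y \<subseteq> \<Union> (B ` I)" using join_on_subset_Pow[of I A B] A assms(1) y by blast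
  define S where "S = {i \<in> I. x \<inter> B i \<noteq> y \<inter> B i}"
  have S: "x \<inter> B i = {} \<and> y \<inter> B i = B i" if "i \<in> S" for i
  proof -
    have i: "i \<in> I" "x \<inter> B i \<subset> y \<inter> B i" using that xy by (auto simp: S_def)
    show ?thesis
      by (rule orthogonal_chainsD[OF orth[OF i(1)] comps[OF x i(1)] comps[OF y i(1)] i(2)])
  qed
  have "y - x = \<Union> (B ` S)"
  proof (intro equalityI subsetI)
    fix e assume e: "e \<in> y - x"
    then obtain i where "i \<in> I" "e \<in> B i" using y_sub by blast
    then show "e \<in> \<Union> (B ` S)" using e by (auto simp: S_def)
  next
    fix e assume "e \<in> \<Union> (B ` S)"
    then obtain i where i: "i \<in> S" "e \<in> B i" by blast
    then have "e \<notin> x \<inter> B i" "e \<in> y \<inter> B i" using S[OF i(1)] by simp_all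
    then show "e \<in> y - x" using i(2) by simp
  qed
  moreover have "S \<subseteq> I" by (auto simp: S_def)
  ultimately have ex: "\<exists>S\<subseteq>I. y - x = \<Union> (B ` S)" by (intro exI[of _ S] conjI)
  have "B i \<subseteq> y - x" if i: "i \<in> I" for i
  proof (rule ccontr)
    assume "\<not> B i \<subseteq> y - x"
    then have "card (A i) = 1" "card (A' i) = 1"
      using comp[OF IntD1[OF x] IntD1[OF y] xy ex] comp'[OF IntD2[OF x] IntD2[OF y] xy ex] i by blast+
    \<comment> \<open>Both singletons contain \<open>x \<inter> B i\<close>, so they are one and the
      same chain, shared by two decompositions.\<close>
    moreover from this have "A i = A' i" using comps[OF x i] by (metis card_1_singletonE singletonD)
    ultimately show False using good[OF i] by blast
  qed
  then show "x = {} \<and> y = \<Union> (B ` I)" using xy y_sub by blast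
qed

text \<open>Stated for an arbitrary ground set, so that it applies to each shifted block as well as
  to their union.\<close>

definition orthogonal_decompositions :: "'j set \<Rightarrow> 'a set \<Rightarrow> ('j \<Rightarrow> 'a set set set) \<Rightarrow> bool" where
  "orthogonal_decompositions J T H \<longleftrightarrow>
     (\<forall>j\<in>J. partition_on (Pow T) (H j) \<and>
       (\<forall>C\<in>H j. \<exists>a b. a + b = card T \<and> saturated_chain C a b)) \<and>
     (\<forall>j\<in>J. \<forall>l\<in>J. j \<noteq> l \<longrightarrow> (\<forall>C\<in>H j. \<forall>D\<in>H l. orthogonal_chains T C D))"

lemma orthogonal_decompositionsD:
  assumes "orthogonal_decompositions J T H" "j \<in> J"
  shows "partition_on (Pow T) (H j)"
    and "\<And>C. C \<in> H j \<Longrightarrow> \<exists>a b. a + b = card T \<and> saturated_chain C a b"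
    and "\<And>l C D. l \<in> J \<Longrightarrow> j \<noteq> l \<Longrightarrow> C \<in> H j \<Longrightarrow> D \<in> H l \<Longrightarrow> orthogonal_chains T C D"
  using assms unfolding orthogonal_decompositions_def by simp_all

text \<open>Each chain remembers a cuboid containing it together with the condition
  \<open>comp\<close>. This condition concerns one decomposition only, so the decompositions for
  different \<open>j\<close> can be chosen independently and are orthogonal nevertheless.\<close>

lemma orthogonal_products:
  fixes B :: "'i \<Rightarrow> 'a set" and P :: "'j \<Rightarrow> 'i \<Rightarrow> 'a set set set"
  assumes I: "finite I" and B: "\<And>i. i \<in> I \<Longrightarrow> 4 \<le> card (B i)" "\<And>i. i \<in> I \<Longrightarrow> even (card (B i))"
    and disj: "\<And>i j. i \<in> I \<Longrightarrow> j \<in> I \<Longrightarrow> i \<noteq> j \<Longrightarrow> B i \<inter> B j = {}"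
    and dec: "\<And>i. i \<in> I \<Longrightarrow> orthogonal_decompositions J (B i) (\<lambda>j. P j i)"
    and good: "\<And>i j l C. i \<in> I \<Longrightarrow> j \<in> J \<Longrightarrow> l \<in> J \<Longrightarrow> j \<noteq> l \<Longrightarrow> C \<in> P j i \<Longrightarrow> C \<in> P l i \<Longrightarrow> card C \<noteq> 1"
  shows "\<exists>H. orthogonal_decompositions J (\<Union> (B ` I)) H \<and>
    (\<forall>j\<in>J. \<forall>C\<in>H j. \<exists>A\<in>Pi\<^sub>E I (P j). C \<subseteq> join_on I A)"
proof -
  note part = orthogonal_decompositionsD(1)[OF dec]
    and ch = orthogonal_decompositionsD(2)[OF dec]
    and orth = orthogonal_decompositionsD(3)[OF dec]
  define comp where "comp A C \<longleftrightarrow> (\<forall>x\<in>C. \<forall>y\<in>C. x \<subset> y \<and> (\<exists>S\<subseteq>I. y - x = \<Union> (B ` S)) \<longrightarrow>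
      (\<forall>i\<in>I. B i \<subseteq> y - x \<or> card (A i) = 1))" for A :: "'i \<Rightarrow> 'a set set" and C
  have compD: "\<forall>i\<in>I. B i \<subseteq> y - x \<or> card (A i) = 1"
    if "comp A C" "x \<in> C" "y \<in> C" "x \<subset> y" "\<exists>S\<subseteq>I. y - x = \<Union> (B ` S)" for A C x y
    using that unfolding comp_def by simp
  define T where "T = \<Union> (B ` I)"
  have cardT: "card T = (\<Sum>i\<in>I. card (B i))"
    unfolding T_def using I B(1) disj by (intro card_UN_disjoint) (auto intro: card_ge_0_finite[OF less_le_trans[of 0 4]])
  have sub: "C \<subseteq> Pow (B i)" if "i \<in> I" "j \<in> J" "C \<in> P j i" for i j C
    using part[OF that(1,2)] that(3) unfolding partition_on_def by blast
  have "decomposable (\<lambda>C. \<exists>A\<in>Pi\<^sub>E I (P j). C \<subseteq> join_on I A \<and> comp A C) (card T) (Pow T)" if j: "j \<in> J" for j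
  proof -
    have "decomposable (\<lambda>C. \<exists>A\<in>Pi\<^sub>E I (P j). C \<subseteq> join_on I A \<and> comp A C) (card T) (join_on I A)"
      if A: "A \<in> Pi\<^sub>E I (P j)" for A
    proof -
      have "\<forall>i\<in>I. \<exists>a b. a + b = card (B i) \<and> saturated_chain (A i) a b" using ch[OF _ j PiE_mem[OF A]] by blast
      then obtain a b where ab: "\<And>i. i \<in> I \<Longrightarrow> a i + b i = card (B i) \<and> saturated_chain (A i) (a i) (b i)" by metis
      have "decomposable (comp A) (\<Sum>i\<in>I. card (B i)) (join_on I A)"
        unfolding comp_def
        by (rule decomposable_block_product[OF I B _ _ _ disj])
          (use ab sub[OF _ j PiE_mem[OF A]] in auto)
      then show ?thesis unfolding cardT by (rule decomposable_mono) (use A in blast)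
    qed
    then have "decomposable (\<lambda>C. \<exists>A\<in>Pi\<^sub>E I (P j). C \<subseteq> join_on I A \<and> comp A C) (card T)
        (\<Union>A\<in>Pi\<^sub>E I (P j). join_on I A)"
      by (rule decomposable_UN) (use UN_join_on_PiE(2)[OF part[OF _ j] disj] in simp_all)
    moreover have "(\<Union>A\<in>Pi\<^sub>E I (P j). join_on I A) = Pow T"
      unfolding T_def by (rule UN_join_on_PiE(1)[OF part[OF _ j] disj])
    ultimately show ?thesis by simp
  qed
  then have "\<forall>j\<in>J. \<exists>\<D>. partition_on (Pow T) \<D> \<and> (\<forall>C\<in>\<D>. (\<exists>A\<in>Pi\<^sub>E I (P j). C \<subseteq> join_on I A \<and> comp A C) \<and>
      (\<exists>a b. a + b = card T \<and> saturated_chain C a b))"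
    unfolding decomposable_def by blast
  from bchoice[OF this] obtain H where *: "\<forall>j\<in>J. partition_on (Pow T) (H j) \<and>
      (\<forall>C\<in>H j. (\<exists>A\<in>Pi\<^sub>E I (P j). C \<subseteq> join_on I A \<and> comp A C) \<and>
        (\<exists>a b. a + b = card T \<and> saturated_chain C a b))" ..
  then have H: "\<And>j. j \<in> J \<Longrightarrow> partition_on (Pow T) (H j)"
    "\<And>j C. j \<in> J \<Longrightarrow> C \<in> H j \<Longrightarrow> \<exists>A\<in>Pi\<^sub>E I (P j). C \<subseteq> join_on I A \<and> comp A C"
    "\<And>j C. j \<in> J \<Longrightarrow> C \<in> H j \<Longrightarrow> \<exists>a b. a + b = card T \<and> saturated_chain C a b"
    by simp_all
  have "orthogonal_chains T C D" if jl: "j \<in> J" "l \<in> J" "j \<noteq> l" and CD: "C \<in> H j" "D \<in> H l" for j l C D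
  proof -
    obtain A where A: "A \<in> Pi\<^sub>E I (P j)" "C \<subseteq> join_on I A" "comp A C" using H(2)[OF jl(1) CD(1)] by blast
    obtain A' where A': "A' \<in> Pi\<^sub>E I (P l)" "D \<subseteq> join_on I A'" "comp A' D" using H(2)[OF jl(2) CD(2)] by blast
    note mem = PiE_mem[OF A(1)] PiE_mem[OF A'(1)]
    show ?thesis unfolding T_def
    proof (rule orthogonal_chains_join[OF A(2) A'(2) _ _ disj])
      show "orthogonal_chains (B i) (A i) (A' i)" if "i \<in> I" for i
        using orth[OF that jl mem(1)[OF that] mem(2)[OF that]] .
      show "card (A i) \<noteq> 1" if "i \<in> I" "A i = A' i" for i
        using good[OF that(1) jl mem(1)[OF that(1)]] mem(2)[OF that(1)] that(2) by simp
      show "A i \<subseteq> Pow (B i)" if "i \<in> I" for i by (rule sub[OF that jl(1) mem(1)[OF that]])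
      show "A' i \<subseteq> Pow (B i)" if "i \<in> I" for i by (rule sub[OF that jl(2) mem(2)[OF that]])
    qed (assumption | rule compD[OF A(3)] compD[OF A'(3)])+
  qed
  then have "orthogonal_decompositions J T H"
    using H(1,3) unfolding orthogonal_decompositions_def by simp
  moreover have "\<exists>A\<in>Pi\<^sub>E I (P j). C \<subseteq> join_on I A" if "j \<in> J" "C \<in> H j" for j C
    using H(2)[OF that] by blast
  ultimately show ?thesis unfolding T_def by (intro exI[of _ H] conjI ballI)
qed

section \<open>Shifted blocks, their size, and the final assembly\<close>

lemma saturated_chain_inj_image:
  assumes "inj h" "saturated_chain C a b"
  shows "saturated_chain ((`) h ` C) a b"
proof -
  obtain f where f: "graded_on f a b" "C = f ` {a..b}"
    using assms(2) unfolding saturated_chain_def by blast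
  have "graded_on (\<lambda>i. h ` f i) a b"
    using f(1) card_image[OF inj_on_subset[OF assms(1) subset_UNIV]]
    unfolding graded_on_def by (simp add: image_mono)
  moreover have "(`) h ` C = (\<lambda>i. h ` f i) ` {a..b}" by (simp add: f(2) image_image)
  ultimately show ?thesis unfolding saturated_chain_def by blast
qed

lemma orthogonal_chains_inj_image:
  assumes "inj h" "orthogonal_chains T C D"
  shows "orthogonal_chains (h ` T) ((`) h ` C) ((`) h ` D)"
  unfolding orthogonal_chains_def
proof (intro ballI impI)
  fix x y assume xy: "x \<in> (`) h ` C \<inter> (`) h ` D" "y \<in> (`) h ` C \<inter> (`) h ` D" "x \<subset> y"
  have "(`) h ` C \<inter> (`) h ` D = (`) h ` (C \<inter> D)"
    using image_Int[OF inj_on_image[of h UNIV]] assms(1) by (simp add: inj_image_eq_iff image_Int inj_def)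
  then obtain x' y' where *: "x' \<in> C \<inter> D" "y' \<in> C \<inter> D" "x = h ` x'" "y = h ` y'" using xy(1,2) by auto
  then have "x' \<subset> y'" using xy(3) inj_image_subset_iff[OF assms(1)] by (simp add: psubset_eq inj_image_eq_iff[OF assms(1)])
  then show "x = {} \<and> y = h ` T" using orthogonal_chainsD[OF assms(2), of x' y'] * by simp
qed

lemma symmetric_chain_decompositionD:
  assumes "symmetric_chain_decomposition n F"
  shows "partition_on (Pow {1..n}) F" and "\<And>C. C \<in> F \<Longrightarrow> symmetric_chain n C"
    and "\<And>C. C \<in> F \<Longrightarrow> \<exists>a b. a + b = n \<and> saturated_chain C a b"
  using assms unfolding symmetric_chain_decomposition_def boolean_lattice_def symmetric_chain_iff by auto

text \<open>Otherwise \<open>{1}\<close> and \<open>{2}\<close> each lie on a chain through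
  \<open>{}\<close>. By disjointness this is the same chain, on which they would be
  comparable.\<close>

lemma singleton_chain_two:
  assumes "symmetric_chain_decomposition 2 F"
  shows "{{1}} \<in> F \<or> {{2}} \<in> F"
proof (rule ccontr)
  assume no: "\<not> ?thesis"
  note F = symmetric_chain_decompositionD[OF assms]
  have ex: "\<exists>C\<in>F. {} \<in> C \<and> {v} \<in> C" if v: "v \<in> {1, 2}" for v :: nat
  proof -
    have "{v} \<in> Pow {1..2}" using v by auto
    then have "{v} \<in> \<Union> F" unfolding partition_onD1[OF F(1)] .
    then obtain C where C: "C \<in> F" "{v} \<in> C" by blast
    obtain a b f where f: "a + b = 2" "graded_on f a b" "C = f ` {a..b}"
      using F(3)[OF C(1)] unfolding saturated_chain_def by blast
    have "a \<noteq> 1"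
    proof
      assume "a = 1"
      then have "C = {f 1}" using f by auto
      then have "C = {{v}}" using C(2) by auto
      then show False using no C(1) v by auto
    qed
    then have "a = 0" using f(1) graded_on_le[OF f(2)] by linarith
    then have "f 0 = {}" "f 0 \<in> C"
      using graded_on_card[OF f(2), of 0] graded_on_finite[OF f(2), of 0] f(3) by auto
    then show ?thesis using C by auto
  qed
  obtain C D where CD: "C \<in> F" "{} \<in> C" "{1} \<in> C" "D \<in> F" "{} \<in> D" "{2} \<in> D"
    using ex[of 1] ex[of 2] by auto
  have "C = D" using partition_onD2[OF F(1)] CD unfolding disjoint_def by blast
  then have "{1} \<subseteq> {2::nat} \<or> {2} \<subseteq> {1::nat}"
    using F(3)[OF CD(1)] chain_comparable CD(3,6) by blast
  then show False by simp
qed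

text \<open>Pigeonhole: for \<open>n = 2\<close> three decompositions would have to share the two
  candidates \<open>{{1}}\<close> and \<open>{{2}}\<close> without repetition.\<close>

lemma good_collection_size:
  assumes "3 \<le> k" "2 \<le> n" "good_collection n k F"
  shows "4 \<le> n"
proof (rule ccontr)
  assume "\<not> 4 \<le> n"
  moreover have "even n" using assms(3) by (simp add: good_collection_def)
  ultimately have n: "n = 2" using assms(2) by presburger
  have scd: "symmetric_chain_decomposition 2 (F j)" if "j \<in> {1..k}" for j
    using assms(3) that n by (simp add: good_collection_def pairwise_almost_orthogonal_SCDs_def)
  have distinct: "\<not> (C \<in> F j \<and> C \<in> F l)" if "j \<in> {1..k}" "l \<in> {1..k}" "j \<noteq> l" "card C = 1" for j l C
    using assms(3) that unfolding good_collection_def by blast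
  have "{{1}} \<in> F j \<or> {{2}} \<in> F j" if "j \<in> {1, 2, 3}" for j
    by (rule singleton_chain_two[OF scd]) (use that assms(1) in auto)
  from this[of 1] this[of 2] this[of 3] show False
    using distinct[of 1 2] distinct[of 1 3] distinct[of 2 3] assms(1) by auto
qed

lemma cuboid_eq_join_on:
  "cuboid r n A = join_on {1..r} (\<lambda>i. (`) ((+) (\<Sum>l = 1..<i. n l)) ` A i)"
proof (intro equalityI subsetI)
  fix z assume "z \<in> cuboid r n A"
  then obtain S where S: "z = (\<Union>i\<in>{1..r}. (+) (\<Sum>l = 1..<i. n l) ` S i)" "\<forall>i\<in>{1..r}. S i \<in> A i"
    unfolding cuboid_def concat_sets_def by blast
  then show "z \<in> join_on {1..r} (\<lambda>i. (`) ((+) (\<Sum>l = 1..<i. n l)) ` A i)"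
    unfolding join_on_def mem_Collect_eq
    by (intro exI[of _ "\<lambda>i. (+) (\<Sum>l = 1..<i. n l) ` S i"]) simp
next
  fix z assume "z \<in> join_on {1..r} (\<lambda>i. (`) ((+) (\<Sum>l = 1..<i. n l)) ` A i)"
  then obtain s where s: "z = \<Union> (s ` {1..r})" "\<forall>i\<in>{1..r}. s i \<in> (`) ((+) (\<Sum>l = 1..<i. n l)) ` A i"
    unfolding join_on_def by blast
  then have "\<forall>i\<in>{1..r}. \<exists>S. S \<in> A i \<and> s i = (+) (\<Sum>l = 1..<i. n l) ` S" by blast
  from bchoice[OF this] obtain S
    where S: "\<forall>i\<in>{1..r}. S i \<in> A i \<and> s i = (+) (\<Sum>l = 1..<i. n l) ` S i" ..
  then have "z = concat_sets r n S"
    unfolding s(1) concat_sets_def by (intro SUP_cong) auto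
  then show "z \<in> cuboid r n A" using S unfolding cuboid_def by blast
qed

text \<open>Half-open intervals between consecutive partial sums make disjointness and the union of
  the blocks a matter of comparing end points.\<close>

lemma block_eq: "(+) (\<Sum>l = 1..<i. n l) ` {1..n i} = {\<Sum>l = 1..<i. n l <.. \<Sum>l = 1..<Suc i. n l}"
  if "1 \<le> i" for n :: "nat \<Rightarrow> nat"
  using that by (simp add: image_add_atLeastAtMost atLeastSucAtMost_greaterThanAtMost)

lemma blocks_disjoint:
  fixes n :: "nat \<Rightarrow> nat"
  assumes "1 \<le> i" "1 \<le> j" "i \<noteq> j"
  shows "(+) (\<Sum>l = 1..<i. n l) ` {1..n i} \<inter> (+) (\<Sum>l = 1..<j. n l) ` {1..n j} = {}"
proof -
  have *: "(\<Sum>l = 1..<Suc i. n l) \<le> (\<Sum>l = 1..<j. n l)" if "i < j" for i j :: nat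
    by (rule sum_mono2) (use that in auto)
  show ?thesis unfolding block_eq[OF assms(1)] block_eq[OF assms(2)]
    using *[of i j] *[of j i] assms(3) by (cases i j rule: linorder_cases) auto
qed

lemma UN_blocks:
  fixes n :: "nat \<Rightarrow> nat"
  shows "(\<Union>i\<in>{1..r}. (+) (\<Sum>l = 1..<i. n l) ` {1..n i}) = {1..\<Sum>i = 1..r. n i}"
proof (induction r)
  case (Suc r)
  have *: "{1..<Suc r} = {1..r}" by auto
  have "{1..Suc r} = insert (Suc r) {1..r}" by auto
  then have "(\<Union>i\<in>{1..Suc r}. (+) (\<Sum>l = 1..<i. n l) ` {1..n i}) =
      (+) (\<Sum>l = 1..<Suc r. n l) ` {1..n (Suc r)} \<union> {1..\<Sum>i = 1..r. n i}"
    using Suc by (simp only: UN_insert)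
  also have "\<dots> = {1..\<Sum>i = 1..Suc r. n i}"
    unfolding * by (auto simp: image_add_atLeastAtMost)
  finally show ?case .
qed simp

theorem theorem8p1:
  fixes k r :: nat and n :: "nat \<Rightarrow> nat"
    and \<F> :: "nat \<Rightarrow> nat \<Rightarrow> nat set set set"
  assumes "k \<ge> 3" and "r \<ge> 1"
    and "\<And>i. i \<in> {1..r} \<Longrightarrow> even (n i) \<and> n i \<ge> 2"
    and "\<And>i. i \<in> {1..r} \<Longrightarrow> good_collection (n i) k (\<F> i)"
  shows "\<exists>\<H> :: nat \<Rightarrow> nat set set set.
           pairwise_almost_orthogonal_SCDs (\<Sum>i = 1..r. n i) k \<H> \<and>
           (\<forall>j\<in>{1..k}. \<forall>C\<in>\<H> j. \<exists>A.
              (\<forall>i\<in>{1..r}. A i \<in> \<F> i j) \<and> C \<subseteq> cuboid r n A)"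
proof -
  define h where "h i = (+) (\<Sum>l = 1..<i. n l)" for i
  define B where "B i = h i ` {1..n i}" for i
  define P where "P j i = (`) ((`) (h i)) ` \<F> i j" for j i
  define N where "N = (\<Sum>i = 1..r. n i)"
  have inj: "inj (h i)" for i by (simp add: h_def)
  have inj2: "inj ((`) (h i))" for i using inj_image_eq_iff[OF inj] by (intro injI) simp
  have cardB: "card (B i) = n i" for i
    unfolding B_def using card_image[OF inj_on_subset[OF inj subset_UNIV]] by simp
  have union: "\<Union> (B ` {1..r}) = {1..N}"
    using UN_blocks[of n r] by (simp add: B_def h_def N_def)
  have scd: "symmetric_chain_decomposition (n i) (\<F> i j)" if "i \<in> {1..r}" "j \<in> {1..k}" for i j
    using assms(4)[OF that(1)] that(2) by (simp add: good_collection_def pairwise_almost_orthogonal_SCDs_def)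
  have "\<exists>H. orthogonal_decompositions {1..k} (\<Union> (B ` {1..r})) H \<and>
    (\<forall>j\<in>{1..k}. \<forall>C\<in>H j. \<exists>A\<in>Pi\<^sub>E {1..r} (P j). C \<subseteq> join_on {1..r} A)"
  proof (rule orthogonal_products)
    fix i assume i: "i \<in> {1..r}"
    show "4 \<le> card (B i)"
      using good_collection_size[OF assms(1) _ assms(4)[OF i]] assms(3)[OF i] by (simp add: cardB)
    show "even (card (B i))" using assms(3)[OF i] by (simp add: cardB)
    show "B i \<inter> B j = {}" if "j \<in> {1..r}" "i \<noteq> j" for j
      unfolding B_def h_def by (rule blocks_disjoint) (use i that in auto)
    have orth: "orthogonal_chains {1..n i} C D"
      if jl: "j \<in> {1..k}" "l \<in> {1..k}" "j \<noteq> l" and CD: "C \<in> \<F> i j" "D \<in> \<F> i l" for j l C D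
    proof -
      have "almost_orthogonal (n i) (\<F> i j) (\<F> i l)"
        using assms(4)[OF i] jl by (simp add: good_collection_def pairwise_almost_orthogonal_SCDs_def)
      then show ?thesis
        using almost_orthogonal_iff[OF symmetric_chain_decompositionD(2)[OF scd[OF i jl(1)]]]
          assms(3)[OF i] CD by simp
    qed
    show "orthogonal_decompositions {1..k} (B i) (\<lambda>j. P j i)"
      unfolding orthogonal_decompositions_def
    proof (intro conjI ballI impI)
      fix j assume j: "j \<in> {1..k}"
      note F = symmetric_chain_decompositionD[OF scd[OF i j]]
      \<comment> \<open>The image of a partition is stated with an empty class removed; as no chain
        is empty, nothing is lost.\<close>
      have "partition_on ((`) (h i) ` Pow {1..n i}) ((`) ((`) (h i)) ` \<F> i j - {{}})"
        by (rule partition_on_inj_image[OF F(1)]) (use inj2 in \<open>rule inj_on_subset, simp\<close>)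
      moreover have "(`) (h i) ` Pow {1..n i} = Pow (B i)" by (rule image_Pow_surj) (simp add: B_def)
      moreover have "{} \<notin> P j i" using partition_onD3[OF F(1)] by (auto simp: P_def)
      ultimately show "partition_on (Pow (B i)) (P j i)" by (simp add: P_def)
      show "\<exists>a b. a + b = card (B i) \<and> saturated_chain C a b" if "C \<in> P j i" for C
        using that F(3) saturated_chain_inj_image[OF inj] unfolding P_def cardB by blast
      fix l C D assume l: "l \<in> {1..k}" "j \<noteq> l" and CD: "C \<in> P j i" "D \<in> P l i"
      show "orthogonal_chains (B i) C D"
        using CD orth[OF j l] orthogonal_chains_inj_image[OF inj] unfolding P_def B_def by auto
    qed
    fix j l C
    assume j: "j \<in> {1..k}" and l: "l \<in> {1..k}" "j \<noteq> l" and C: "C \<in> P j i" "C \<in> P l i"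
    show "card C \<noteq> 1"
    proof
      assume 1: "card C = 1"
      obtain D D' where D: "D \<in> \<F> i j" "D' \<in> \<F> i l" "C = (`) (h i) ` D" "C = (`) (h i) ` D'"
        using C unfolding P_def by blast
      have "(`) (h i) ` D = (`) (h i) ` D'" using D(3,4) by simp
      then have "D = D'" by (simp only: inj_image_eq_iff[OF inj2])
      moreover have "card D = 1" using 1 D(3) card_image[OF inj_on_subset[OF inj2 subset_UNIV]] by simp
      moreover have "\<not> (\<exists>C. card C = 1 \<and> C \<in> \<F> i j \<and> C \<in> \<F> i l)"
        using assms(4)[OF i] j l by (simp add: good_collection_def)
      ultimately show False using D(1,2) by auto
    qed
  qed simp
  then obtain H where H: "orthogonal_decompositions {1..k} {1..N} H"
    "\<And>j C. j \<in> {1..k} \<Longrightarrow> C \<in> H j \<Longrightarrow> \<exists>A\<in>Pi\<^sub>E {1..r} (P j). C \<subseteq> join_on {1..r} A"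
    unfolding union by auto
  note HD = orthogonal_decompositionsD[OF H(1)]
  \<comment> \<open>\<open>1 \<le> r\<close> makes the ground set nonempty, as the criterion for
    almost orthogonality requires.\<close>
  have pos: "0 < N"
    using assms(2) assms(3)[of 1] member_le_sum[of 1 "{1..r}" n] unfolding N_def by fastforce
  have sc: "symmetric_chain N C" if "j \<in> {1..k}" "C \<in> H j" for j C
  proof -
    have "C \<subseteq> Pow {1..N}" using HD(1)[OF that(1)] that(2) unfolding partition_on_def by blast
    then show ?thesis using HD(2)[OF that] by (simp add: symmetric_chain_iff)
  qed
  have "pairwise_almost_orthogonal_SCDs N k H"
    unfolding pairwise_almost_orthogonal_SCDs_def
  proof (intro conjI ballI impI)
    show "symmetric_chain_decomposition N (H j)" if "j \<in> {1..k}" for j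
      using HD(1)[OF that] sc[OF that]
      by (simp add: symmetric_chain_decomposition_def boolean_lattice_def)
    show "almost_orthogonal N (H j) (H l)" if jl: "j \<in> {1..k}" "l \<in> {1..k}" "j \<noteq> l" for j l
      using HD(3)[OF jl] almost_orthogonal_iff[OF sc[OF jl(1)] pos] by simp
  qed
  moreover have "\<exists>A. (\<forall>i\<in>{1..r}. A i \<in> \<F> i j) \<and> C \<subseteq> cuboid r n A" if j: "j \<in> {1..k}" "C \<in> H j" for j C
  proof -
    obtain A where A: "A \<in> Pi\<^sub>E {1..r} (P j)" "C \<subseteq> join_on {1..r} A" using H(2)[OF j] by blast
    \<comment> \<open>Undoing the shifts: each factor \<open>A i\<close> is the image of a chain of
      the original decomposition, and these chains span the required cuboid.\<close>
    have "\<exists>D. D \<in> \<F> i j \<and> A i = (`) (h i) ` D" if "i \<in> {1..r}" for i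
      using PiE_mem[OF A(1) that] by (auto simp: P_def)
    then have "\<forall>i\<in>{1..r}. \<exists>D. D \<in> \<F> i j \<and> A i = (`) (h i) ` D" ..
    from bchoice[OF this] obtain D where D: "\<forall>i\<in>{1..r}. D i \<in> \<F> i j \<and> A i = (`) (h i) ` D i" ..
    then have "join_on {1..r} A = cuboid r n D"
      unfolding cuboid_eq_join_on h_def by (intro join_on_cong) simp
    then show ?thesis using D A(2) by (intro exI[of _ D]) simp
  qed
  ultimately show ?thesis unfolding N_def by blast
qed

end
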